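(* Let $V$ be a finite set, let $\mu$ be a distribution over $\{-1,+1\}^V$, and let $\eta>0$. If $\mu$ is completely $\eta$-spectrally independent, then for all $\theta\in(0,1)$, \[ \mathrm{gap}_{\mathsf{GD}}(\mu)\ge\left(\frac{\theta}{2}\right)^{2\eta+7}\cdot \mathrm{gap}^{\min}_{\mathsf{GD}}\left(\mu^{(\theta)}\right). \]
   Context: For a distribution $\mu$ on $\{-1,+1\}^V$, $\Omega(\mu)$ is its support; for $\Lambda\subseteq V$, $\mu_\Lambda$ is the marginal on $\Lambda$, and $\sigma_\Lambda\in\{-1,+1\}^\Lambda$ is feasible if $\sigma_\Lambda\in\Omega(\mu_\Lambda)$; then $\mu^{\sigma_\Lambda}$ is $\mu$ conditioned on the configuration on $\Lambda$ being $\sigma_\Lambda$, $\mu^{\sigma_\Lambda}_S$ its marginal on $S$, and $\mu^{\sigma_\Lambda,u\gets c}_v$ the marginal at $v$ of $\mu$ conditioned additionally on the spin of $u$ being $c$. Influence matrix: for $\Lambda\subseteq V$ and feasible $\sigma_\Lambda$, $\Psi^{\sigma_\Lambda}_\mu\in\mathbb{R}^{(V\setminus\Lambda)\times(V\setminus\Lambda)}$ has zero diagonal and, for distinct $u,v\in V\setminus\Lambda$, $\Psi^{\sigma_\Lambda}_\mu(u,v)=\max_{c,c'\in\Omega(\mu^{\sigma_\Lambda}_u)} d_{TV}\left(\mu^{\sigma_\Lambda,u\gets c}_v,\mu^{\sigma_\Lambda,u\gets c'}_v\right)$. $\mu$ is $\eta$-spectrally independent if the spectral radius $\rho(\Psi^{\sigma_\Lambda}_\mu)\le\eta$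 for all $\Lambda\subseteq V$ and all feasible $\sigma_\Lambda$. For $\boldsymbol\phi\in(0,\infty)^V$, $\mu^{(\boldsymbol\phi)}$ is the distribution with $\mu^{(\boldsymbol\phi)}(\sigma)\propto\mu(\sigma)\prod_{v:\sigma_v=+1}\phi_v$; for a scalar $\theta>0$, $\mu^{(\theta)}=\mu^{(\boldsymbol\phi)}$ with $\phi_v=\theta$ for all $v$. $\mu$ is completely $\eta$-spectrally independent if $\mu^{(\boldsymbol\phi)}$ is $\eta$-spectrally independent for all $\boldsymbol\phi\in(0,1]^V$. The Glauber dynamics for $\mu$ is the Markov chain on $\Omega(\mu)$ that picks $v\in V$ uniformly at random and resamples the spin of $v$ from $\mu$ conditioned on the current spins of $V\setminus\{v\}$; it is reversible w.r.t. $\mu$, and $\mathrm{gap}_{\mathsf{GD}}(\mu)=1-\lambda_2$ where $\lambda_2$ is the second largest eigenvalue of its transition matrix, with the convention $\mathrm{gap}_{\mathsf{GD}}(\mu)=1$ if $|\Omega(\mu)|=1$. Finally $\mathrm{gap}^{\min}_{\mathsf{GD}}(\mu)=\min_{\Lambda\subseteq V,\ \sigma_\Lambda\in\Omega(\mu_\Lambda)}\mathrm{gap}_{\mathsf{GD}}(\mu^{\sigma_\Lambda})$. *)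

theory Defs
  imports "HOL-Probability.Probability" "Jordan_Normal_Form.Spectral_Radius"
begin

section \<open>Matrices indexed by a finite set\<close>

text \<open>
  Matrices of the library are indexed by natural numbers, so a matrix with rows and columns
  indexed by a finite set \<open>S\<close> is listed along an arbitrary enumeration of \<open>S\<close>. Changing the
  enumeration conjugates the matrix by a permutation matrix; only the eigenvalues (with
  multiplicity) are used below, and these do not depend on it.
\<close>

definition enum_of :: "'a set \<Rightarrow> 'a list" where
  "enum_of S = (SOME xs. distinct xs \<and> set xs = S)"

definition mat_on :: "'a set \<Rightarrow> ('a \<Rightarrow> 'a \<Rightarrow> 'b) \<Rightarrow> 'b mat" where
  "mat_on S A = mat (card S) (card S) (\<lambda>(i, j). A (enum_of S ! i) (enum_of S ! j))"

lemma enum_of: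
  assumes "finite S"
  shows "distinct (enum_of S)" "set (enum_of S) = S" "length (enum_of S) = card S"
proof -
  have "\<exists>xs. distinct xs \<and> set xs = S"
    using finite_distinct_list[OF assms] by blast
  then have *: "distinct (enum_of S) \<and> set (enum_of S) = S"
    unfolding enum_of_def by (rule someI_ex)
  then show "distinct (enum_of S)" "set (enum_of S) = S" by auto
  with * show "length (enum_of S) = card S"
    using distinct_card by metis
qed

text \<open>
  The empty matrix has no eigenvalues, and \<^const>\<open>spectral_radius\<close> is unspecified for it; its
  spectral radius is taken to be \<open>0\<close>.
\<close>

definition spectral_radius_on :: "'a set \<Rightarrow> ('a \<Rightarrow> 'a \<Rightarrow> real) \<Rightarrow> real" where
  "spectral_radius_on S A =
     (if S = {} then 0 else spectral_radius (mat_on S (\<lambda>x y. complex_of_real (A x y))))"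

text \<open>
  Second largest eigenvalue, counted with multiplicity as a root of the characteristic
  polynomial. \<^const>\<open>proots\<close> collects the real roots only; this is used for transition matrices of
  reversible chains with at least two states, all of whose eigenvalues are real.
\<close>

definition second_eigenvalue_on :: "'a set \<Rightarrow> ('a \<Rightarrow> 'a \<Rightarrow> real) \<Rightarrow> real" where
  "second_eigenvalue_on S A =
     rev (sorted_list_of_multiset (proots (char_poly (mat_on S A)))) ! 1"


section \<open>Spin distributions\<close>

text \<open>
  \<open>{-1,+1}\<^sup>\<Lambda>\<close> is the set of functions \<open>\<Lambda> \<rightarrow>\<^sub>E {-1, 1}\<close> (equal to \<^const>\<open>undefined\<close> outside
  \<open>\<Lambda>\<close>), and a distribution over it is a pmf supported in this set.
\<close>

type_synonym 'v config = "'v \<Rightarrow> int"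

definition configs :: "'v set \<Rightarrow> 'v config set" where
  "configs \<Lambda> = (\<Lambda> \<rightarrow>\<^sub>E {-1, 1})"

lemma finite_configs: "finite \<Lambda> \<Longrightarrow> finite (configs \<Lambda>)"
  by (simp add: configs_def finite_PiE)

definition marginal :: "'v config pmf \<Rightarrow> 'v set \<Rightarrow> 'v config pmf" where
  "marginal \<mu> \<Lambda> = map_pmf (\<lambda>\<sigma>. restrict \<sigma> \<Lambda>) \<mu>"

text \<open>Marginal at a single site, as a distribution over spins.\<close>

definition marginal_at :: "'v config pmf \<Rightarrow> 'v \<Rightarrow> int pmf" where
  "marginal_at \<mu> v = map_pmf (\<lambda>\<sigma>. \<sigma> v) \<mu>"

definition feasible :: "'v config pmf \<Rightarrow> 'v set \<Rightarrow> 'v config \<Rightarrow> bool" where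
  "feasible \<mu> \<Lambda> \<tau> \<longleftrightarrow> \<tau> \<in> set_pmf (marginal \<mu> \<Lambda>)"

text \<open>
  Conditioning keeps the sites of \<open>\<Lambda>\<close>: the result is again a distribution over all of
  \<open>{-1,+1}\<^sup>V\<close>. It is only meaningful for feasible \<open>\<tau>\<close>.
\<close>

definition pinned :: "'v config pmf \<Rightarrow> 'v set \<Rightarrow> 'v config \<Rightarrow> 'v config pmf" where
  "pinned \<mu> \<Lambda> \<tau> = cond_pmf \<mu> {\<sigma>. restrict \<sigma> \<Lambda> = \<tau>}"

definition pinned_at :: "'v config pmf \<Rightarrow> 'v \<Rightarrow> int \<Rightarrow> 'v config pmf" where
  "pinned_at \<mu> u c = cond_pmf \<mu> {\<sigma>. \<sigma> u = c}"

text \<open>Total variation distance; only used for finitely supported distributions.\<close>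

definition tv_dist :: "'a pmf \<Rightarrow> 'a pmf \<Rightarrow> real" where
  "tv_dist p q = (\<Sum>x \<in> set_pmf p \<union> set_pmf q. \<bar>pmf p x - pmf q x\<bar>) / 2"


section \<open>Spectral independence\<close>

definition influence :: "'v config pmf \<Rightarrow> 'v set \<Rightarrow> 'v config \<Rightarrow> 'v \<Rightarrow> 'v \<Rightarrow> real" where
  "influence \<mu> \<Lambda> \<tau> u v =
     (if u = v then 0 else
        Max {tv_dist (marginal_at (pinned_at (pinned \<mu> \<Lambda> \<tau>) u c) v)
                     (marginal_at (pinned_at (pinned \<mu> \<Lambda> \<tau>) u c') v) | c c'.
               c \<in> set_pmf (marginal_at (pinned \<mu> \<Lambda> \<tau>) u) \<and>
               c' \<in> set_pmf (marginal_at (pinned \<mu> \<Lambda> \<tau>) u)})"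

definition spectrally_independent :: "'v set \<Rightarrow> real \<Rightarrow> 'v config pmf \<Rightarrow> bool" where
  "spectrally_independent V \<eta> \<mu> \<longleftrightarrow>
     (\<forall>\<Lambda> \<tau>. \<Lambda> \<subseteq> V \<longrightarrow> feasible \<mu> \<Lambda> \<tau> \<longrightarrow>
        spectral_radius_on (V - \<Lambda>) (influence \<mu> \<Lambda> \<tau>) \<le> \<eta>)"

definition tilt_weight :: "'v set \<Rightarrow> ('v \<Rightarrow> real) \<Rightarrow> 'v config \<Rightarrow> real" where
  "tilt_weight V \<phi> \<sigma> = (\<Prod>v \<in> {v \<in> V. \<sigma> v = 1}. \<phi> v)"

definition tilt :: "'v set \<Rightarrow> ('v \<Rightarrow> real) \<Rightarrow> 'v config pmf \<Rightarrow> 'v config pmf" where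
  "tilt V \<phi> \<mu> = embed_pmf (\<lambda>\<sigma>. pmf \<mu> \<sigma> * tilt_weight V \<phi> \<sigma> /
                              (\<Sum>\<sigma>' \<in> set_pmf \<mu>. pmf \<mu> \<sigma>' * tilt_weight V \<phi> \<sigma>'))"

text \<open>\<^const>\<open>embed_pmf\<close> is total, so the following is needed for \<^const>\<open>tilt\<close> to be as intended.\<close>

lemma pmf_tilt:
  assumes fin: "finite (set_pmf \<mu>)" and pos: "\<And>v. v \<in> V \<Longrightarrow> 0 < \<phi> v"
  shows "pmf (tilt V \<phi> \<mu>) \<sigma> = pmf \<mu> \<sigma> * tilt_weight V \<phi> \<sigma> /
           (\<Sum>\<sigma>' \<in> set_pmf \<mu>. pmf \<mu> \<sigma>' * tilt_weight V \<phi> \<sigma>')"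
proof -
  define Z where "Z = (\<Sum>\<sigma>' \<in> set_pmf \<mu>. pmf \<mu> \<sigma>' * tilt_weight V \<phi> \<sigma>')"
  define f where "f \<sigma> = pmf \<mu> \<sigma> * tilt_weight V \<phi> \<sigma> / Z" for \<sigma>
  have w: "0 < tilt_weight V \<phi> \<sigma>" for \<sigma>
    unfolding tilt_weight_def by (rule prod_pos) (use pos in auto)
  have Z: "0 < Z"
    unfolding Z_def
    by (rule sum_pos[OF fin set_pmf_not_empty]) (use w in \<open>auto simp: pmf_positive\<close>)
  have nn: "0 \<le> f \<sigma>" for \<sigma>
    unfolding f_def using w[of \<sigma>] Z by (simp add: less_imp_le)
  have "(\<integral>\<^sup>+\<sigma>. ennreal (f \<sigma>) \<partial>count_space UNIV) = (\<Sum>\<sigma>\<in>set_pmf \<mu>. ennreal (f \<sigma>))"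
    by (rule nn_integral_count_space'[OF fin]) (auto simp: f_def set_pmf_iff)
  also have "\<dots> = ennreal (\<Sum>\<sigma>\<in>set_pmf \<mu>. f \<sigma>)"
    by (rule sum_ennreal) (rule nn)
  also have "(\<Sum>\<sigma>\<in>set_pmf \<mu>. f \<sigma>) = 1"
    unfolding f_def using Z by (simp add: sum_divide_distrib[symmetric] Z_def)
  finally have int: "(\<integral>\<^sup>+\<sigma>. ennreal (f \<sigma>) \<partial>count_space UNIV) = 1" by simp
  have "tilt V \<phi> \<mu> = embed_pmf f"
    unfolding tilt_def f_def Z_def ..
  then have "pmf (tilt V \<phi> \<mu>) \<sigma> = f \<sigma>"
    using pmf_embed_pmf[OF nn int] by simp
  then show ?thesis
    by (simp add: f_def Z_def)
qed

definition completely_spectrally_independent :: "'v set \<Rightarrow> real \<Rightarrow> 'v config pmf \<Rightarrow> bool" where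
  "completely_spectrally_independent V \<eta> \<mu> \<longleftrightarrow>
     (\<forall>\<phi>. (\<forall>v\<in>V. 0 < \<phi> v \<and> \<phi> v \<le> 1) \<longrightarrow> spectrally_independent V \<eta> (tilt V \<phi> \<mu>))"


section \<open>Glauber dynamics\<close>

definition glauber :: "'v set \<Rightarrow> 'v config pmf \<Rightarrow> 'v config \<Rightarrow> 'v config pmf" where
  "glauber V \<mu> \<sigma> =
     do {
       v \<leftarrow> pmf_of_set V;
       c \<leftarrow> marginal_at (pinned \<mu> (V - {v}) (restrict \<sigma> (V - {v}))) v;
       return_pmf (\<sigma>(v := c))
     }"

definition gap_GD :: "'v set \<Rightarrow> 'v config pmf \<Rightarrow> real" where
  "gap_GD V \<mu> =
     (if card (set_pmf \<mu>) = 1 then 1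
      else 1 - second_eigenvalue_on (set_pmf \<mu>) (\<lambda>\<sigma> \<sigma>'. pmf (glauber V \<mu> \<sigma>) \<sigma>'))"

text \<open>
  The chain for a conditioned distribution still picks its site uniformly from all of \<open>V\<close>; nothing
  changes when a conditioned site is picked.
\<close>

definition gap_GD_min :: "'v set \<Rightarrow> 'v config pmf \<Rightarrow> real" where
  "gap_GD_min V \<mu> = Min {gap_GD V (pinned \<mu> \<Lambda> \<tau>) | \<Lambda> \<tau>. \<Lambda> \<subseteq> V \<and> feasible \<mu> \<Lambda> \<tau>}"

end

theory Submission
  imports Defs
begin

text \<open>
  The proof follows the negative-field localization. Reveal the sites with spin \<open>+1\<close>, each
  independently with probability \<open>1 - t\<close>; given the revealed set \<open>R\<close>, the conditional law is
  \<open>\<mu>\<^sub>R = (tilt of \<mu> by t)\<close> pinned to \<open>+1\<close> on \<open>R\<close>. Let \<open>G t\<close> be the expectation of the variance of \<open>f\<close>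
  under \<open>\<mu>\<^sub>R\<close>, so that \<open>G 1\<close> is the variance of \<open>f\<close> under \<open>\<mu>\<close>. Then \<open>G' t\<close> is \<open>1 / t\<close> times the
  expectation of \<open>\<Sum>\<^sub>v (cov f 1\<^sub>v)\<^sup>2 / p\<^sub>v\<close> under \<open>\<mu>\<^sub>R\<close>, where \<open>1\<^sub>v\<close> is the indicator of spin \<open>+1\<close> at \<open>v\<close>
  and \<open>p\<^sub>v\<close> its mean. The matrix \<open>cov 1\<^sub>u 1\<^sub>v / p\<^sub>u\<close> is bounded entrywise by the identity plus the
  influence matrix, so by Schur's test and duality that sum is at most \<open>1 + \<eta>\<close> times the variance.
  Hence \<open>G' \<le> (1 + \<eta>) / t * G\<close>, and by Gronwall's inequality the variance under \<open>\<mu>\<close> is at most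
  \<open>\<theta> powr - (1 + \<eta>) * G \<theta>\<close>. Poincare's inequality for each \<open>\<mu>\<^sub>R\<close> and the fact that the Dirichlet form
  can only decrease on average under conditioning give the bound with the better factor
  \<open>\<theta> powr (1 + \<eta>)\<close>.
\<close>

section \<open>Spectral theorem for real symmetric matrices\<close>

text \<open>Over the complex numbers some eigenvector \<open>z\<close> exists. Its eigenvalue is
  real by symmetry, so the real and imaginary parts of \<open>z\<close> satisfy the eigenvalue
  equation separately, and one of them is nonzero and can be normalised.\<close>

lemma symmetric_eigenvector_exists:
  fixes A :: "real mat"
  assumes A: "A \<in> carrier_mat n n" and n: "n > 0"
    and sym: "\<And>i j. i < n \<Longrightarrow> j < n \<Longrightarrow> A $$ (i, j) = A $$ (j, i)"
  obtains e v where "v \<in> carrier_vec n" "scalar_prod v v = 1" "A *\<^sub>v v = e \<cdot>\<^sub>v v"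
proof -
  define C where "C = map_mat complex_of_real A"
  have C: "C \<in> carrier_mat n n" using A by (simp add: C_def)
  obtain e z where z: "z \<in> carrier_vec n" "z \<noteq> 0\<^sub>v n" "C *\<^sub>v z = e \<cdot>\<^sub>v z"
    using spectrum_non_empty[OF C n] C
    by (auto simp: spectrum_def eigenvalue_def eigenvector_def)
  have ev: "(\<Sum>j<n. of_real (A $$ (i, j)) * vec_index z j) = e * vec_index z i" if "i < n" for i
  proof -
    have "vec_index (C *\<^sub>v z) i = vec_index (e \<cdot>\<^sub>v z) i" using z by simp
    then show ?thesis using that A z(1)
      by (simp add: C_def scalar_prod_def atLeast0LessThan)
  qed
  define N where "N = (\<Sum>i<n. (cmod (vec_index z i))\<^sup>2)"
  obtain i0 where i0: "i0 < n" "vec_index z i0 \<noteq> 0"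
    using z(1,2) by (metis eq_vecI carrier_vecD index_zero_vec(1) index_zero_vec(2))
  have Npos: "N > 0"
    unfolding N_def by (rule sum_pos2[of _ i0]) (use i0 in auto)
  \<comment> \<open>\<open>q\<close> is the Hermitian form of \<open>A\<close> at \<open>z\<close>.
    The eigenvalue equation gives \<open>q = e * N\<close>, symmetry gives \<open>cnj q = q\<close>,
    and \<open>N > 0\<close> then forces \<open>e\<close> to be real.\<close>
  define q where "q = (\<Sum>i<n. \<Sum>j<n. cnj (vec_index z i) * (of_real (A $$ (i, j)) * vec_index z j))"
  have "q = (\<Sum>i<n. cnj (vec_index z i) * (e * vec_index z i))"
    unfolding q_def by (rule sum.cong) (auto simp: ev sum_distrib_left[symmetric])
  also have "\<dots> = (\<Sum>i<n. e * of_real ((cmod (vec_index z i))\<^sup>2))"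
    by (intro sum.cong) (auto simp: complex_norm_square[symmetric] algebra_simps simp flip: of_real_power)
  also have "\<dots> = e * of_real N"
    by (simp add: N_def sum_distrib_left)
  finally have q1: "q = e * of_real N" .
  have "cnj q = (\<Sum>i<n. \<Sum>j<n. vec_index z i * (of_real (A $$ (i, j)) * cnj (vec_index z j)))"
    by (simp add: q_def)
  also have "\<dots> = (\<Sum>j<n. \<Sum>i<n. vec_index z i * (of_real (A $$ (i, j)) * cnj (vec_index z j)))"
    by (rule sum.swap)
  also have "\<dots> = q"
    unfolding q_def by (intro sum.cong refl) (auto simp: sym algebra_simps)
  finally have "cnj q = q" .
  then have "cnj e = e" using q1 Npos by simp
  then have e: "e = of_real (Re e)"
    by (metis complex_cnj_cancel_iff complex_is_Real_iff complex_eq_iff cnj.simps of_real_Re Reals_cnj_iff)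
  define w where "w f = vec n (\<lambda>i. f (vec_index z i))" for f :: "complex \<Rightarrow> real"
  have wRe: "A *\<^sub>v w Re = Re e \<cdot>\<^sub>v w Re"
  proof (rule eq_vecI)
    fix i assume i: "i < dim_vec (Re e \<cdot>\<^sub>v w Re)"
    then have i': "i < n" by (simp add: w_def)
    have "Re (\<Sum>j<n. of_real (A $$ (i, j)) * vec_index z j) = Re (of_real (Re e) * vec_index z i)"
      using ev[OF i'] e by simp
    then show "vec_index (A *\<^sub>v w Re) i = vec_index (Re e \<cdot>\<^sub>v w Re) i"
      using i' A by (simp add: w_def scalar_prod_def atLeast0LessThan)
  qed (use A in \<open>simp add: w_def\<close>)
  have wIm: "A *\<^sub>v w Im = Re e \<cdot>\<^sub>v w Im"
  proof (rule eq_vecI)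
    fix i assume i: "i < dim_vec (Re e \<cdot>\<^sub>v w Im)"
    then have i': "i < n" by (simp add: w_def)
    have "Im (\<Sum>j<n. of_real (A $$ (i, j)) * vec_index z j) = Im (of_real (Re e) * vec_index z i)"
      using ev[OF i'] e by simp
    then show "vec_index (A *\<^sub>v w Im) i = vec_index (Re e \<cdot>\<^sub>v w Im) i"
      using i' A by (simp add: w_def scalar_prod_def atLeast0LessThan)
  qed (use A in \<open>simp add: w_def\<close>)
  have "\<exists>x. x \<in> carrier_vec n \<and> x \<noteq> 0\<^sub>v n \<and> A *\<^sub>v x = Re e \<cdot>\<^sub>v x"
  proof (cases "Re (vec_index z i0) = 0")
    case True
    then have "vec_index (w Im) i0 \<noteq> 0" using i0 by (simp add: w_def complex_eq_iff)
    then have "w Im \<noteq> 0\<^sub>v n" using i0 by auto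
    then show ?thesis using wIm by (intro exI[of _ "w Im"]) (auto simp: w_def)
  next
    case False
    then have "vec_index (w Re) i0 \<noteq> 0" using i0 by (simp add: w_def)
    then have "w Re \<noteq> 0\<^sub>v n" using i0 by auto
    then show ?thesis using wRe by (intro exI[of _ "w Re"]) (auto simp: w_def)
  qed
  then obtain x where x: "x \<in> carrier_vec n" "x \<noteq> 0\<^sub>v n" "A *\<^sub>v x = Re e \<cdot>\<^sub>v x" by blast
  have "scalar_prod x x > 0"
    using x conjugate_square_greater_0_vec[of x n] by simp
  then have "scalar_prod ((1 / sqrt (scalar_prod x x)) \<cdot>\<^sub>v x) ((1 / sqrt (scalar_prod x x)) \<cdot>\<^sub>v x) = 1"
    using x(1) by (simp add: field_simps)
  moreover have "A *\<^sub>v ((1 / sqrt (scalar_prod x x)) \<cdot>\<^sub>v x) = Re e \<cdot>\<^sub>v ((1 / sqrt (scalar_prod x x)) \<cdot>\<^sub>v x)"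
    using x A by (simp add: mult_mat_vec smult_smult_assoc mult.commute)
  moreover have "(1 / sqrt (scalar_prod x x)) \<cdot>\<^sub>v x \<in> carrier_vec n"
    using x(1) by simp
  ultimately show thesis
    by (intro that)
qed

text \<open>\<open>W\<close> reflects in the hyperplane orthogonal to
  \<open>unit_vec n 0 - v\<close>, so it swaps these two unit vectors. If they coincide then
  \<open>c = 0\<close>, and since division by zero gives zero, \<open>W\<close> is the
  identity.\<close>

lemma householder_reflection_exists:
  fixes v :: "real vec"
  assumes v: "v \<in> carrier_vec n" "scalar_prod v v = 1" and n: "n > 0"
  obtains W where "W \<in> carrier_mat n n" "transpose_mat W = W" "W * W = 1\<^sub>m n"
    "W *\<^sub>v unit_vec n 0 = v"
proof -
  define w where "w i = (if i = 0 then 1 else 0) - vec_index v i" for i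
  define c where "c = (\<Sum>i<n. (w i)\<^sup>2)"
  define W where "W = mat n n (\<lambda>(i, j). (if i = j then 1 else 0) - 2 * w i * w j / c)"
  have W: "W \<in> carrier_mat n n" by (simp add: W_def)
  have vv: "(\<Sum>i<n. (vec_index v i)\<^sup>2) = 1"
    using v by (simp add: scalar_prod_def power2_eq_square atLeast0LessThan)
  have "c = (\<Sum>i<n. (if i = 0 then 1 - 2 * vec_index v i else 0) + (vec_index v i)\<^sup>2)"
    unfolding c_def w_def by (intro sum.cong) (auto simp: power2_eq_square algebra_simps)
  also have "\<dots> = 2 - 2 * vec_index v 0"
    using n by (simp add: sum.distrib vv)
  \<comment> \<open>Because \<open>v\<close> is a unit vector, the squared length of
    \<open>w\<close> is linear in \<open>w 0\<close>; this is what makes the reflection send the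
    first basis vector exactly to \<open>v\<close>.\<close>
  finally have c: "c = 2 * w 0" by (simp add: w_def)
  have "transpose_mat W = W"
    by (rule eq_matI) (auto simp: W_def)
  moreover have "W * W = 1\<^sub>m n"
  proof (rule eq_matI)
    fix i j assume "i < dim_row (1\<^sub>m n :: real mat)" "j < dim_col (1\<^sub>m n :: real mat)"
    then have ij: "i < n" "j < n" by auto
    have "(W * W) $$ (i, j) = (\<Sum>k<n. ((if i = k then 1 else 0) - 2 * w i * w k / c) *
                                     ((if k = j then 1 else 0) - 2 * w k * w j / c))"
      using ij by (simp add: W_def scalar_prod_def atLeast0LessThan)
    also have "\<dots> = (\<Sum>k<n. (if k = i then (if i = j then 1 else 0) - 2 * w i * w j / c else 0)
           - (if k = j then 2 * w i * w j / c else 0) + (4 * w i * w j / c\<^sup>2) * (w k)\<^sup>2)"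
      by (intro sum.cong) (auto simp: algebra_simps power2_eq_square)
    also have "\<dots> = (if i = j then 1 else 0) - 4 * w i * w j / c + 4 * w i * w j / c\<^sup>2 * c"
      using ij by (simp only: sum.distrib sum_subtractf sum_distrib_left[symmetric] c_def[symmetric]) simp
    also have "\<dots> = 1\<^sub>m n $$ (i, j)"
      using ij by (simp add: power2_eq_square)
    finally show "(W * W) $$ (i, j) = 1\<^sub>m n $$ (i, j)" .
  qed (auto simp: W_def)
  moreover have "W *\<^sub>v unit_vec n 0 = v"
  proof (rule eq_vecI)
    fix i assume "i < dim_vec v"
    then have i: "i < n" using v by auto
    have "vec_index (W *\<^sub>v unit_vec n 0) i = (if i = 0 then 1 else 0) - 2 * w i * w 0 / c"
      using i n by (simp add: W_def)
    also have "\<dots> = vec_index v i"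
    proof (cases "c = 0")
      case True
      then have "w i = 0" using i by (auto simp: c_def sum_nonneg_eq_0_iff)
      then show ?thesis by (simp add: w_def split: if_splits)
    next
      case False
      then have "2 * w i * w 0 / c = w i" using c by simp
      then show ?thesis by (simp add: w_def)
    qed
    finally show "vec_index (W *\<^sub>v unit_vec n 0) i = vec_index v i" .
  qed (use v W in auto)
  ultimately show thesis using that W by blast
qed

text \<open>Induction by deflation. Conjugating with a reflection that carries the first basis
  vector to a unit eigenvector leaves only \<open>e\<close> in the first column, hence by symmetry
  also in the first row; the remaining block \<open>C\<close> is symmetric and one size
  smaller.\<close>

theorem symmetric_diagonalizable:
  fixes A :: "real mat"
  assumes "A \<in> carrier_mat n n" "transpose_mat A = A"
  shows "\<exists>U D. U \<in> carrier_mat n n \<and> D \<in> carrier_mat n n \<and> transpose_mat U * U = 1\<^sub>m n \<and>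
           diagonal_mat D \<and> A * U = U * D"
  using assms
proof (induction n arbitrary: A)
  case 0
  then show ?case
    by (intro exI[of _ "1\<^sub>m 0"]) (auto simp: diagonal_mat_def intro!: eq_matI)
next
  case (Suc n)
  note A = Suc.prems(1) and tA = Suc.prems(2)
  have symA: "A $$ (i, j) = A $$ (j, i)" if "i < Suc n" "j < Suc n" for i j
    using that A by (metis tA carrier_matD index_transpose_mat(1))
  obtain e v where v: "v \<in> carrier_vec (Suc n)" "scalar_prod v v = 1" "A *\<^sub>v v = e \<cdot>\<^sub>v v"
    using symmetric_eigenvector_exists[OF A _ symA] by blast
  obtain W where W: "W \<in> carrier_mat (Suc n) (Suc n)" and tW: "transpose_mat W = W"
    and WW: "W * W = 1\<^sub>m (Suc n)" and We: "W *\<^sub>v unit_vec (Suc n) 0 = v"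
    using householder_reflection_exists[OF v(1,2)] by blast
  define B where "B = W * A * W"
  have B: "B \<in> carrier_mat (Suc n) (Suc n)" using W A by (simp add: B_def)
  have tB: "transpose_mat B = B"
    unfolding B_def using W A
    by (simp add: transpose_mult[of _ "Suc n" "Suc n" _ "Suc n"] tW tA assoc_mult_mat[of _ "Suc n" "Suc n" _ "Suc n" _ "Suc n"])
  have "B *\<^sub>v unit_vec (Suc n) 0 = W *\<^sub>v (A *\<^sub>v (W *\<^sub>v unit_vec (Suc n) 0))"
    unfolding B_def using W A by (simp add: assoc_mult_mat_vec[of _ "Suc n" "Suc n" _ "Suc n"])
  also have "\<dots> = e \<cdot>\<^sub>v (W *\<^sub>v v)"
    using W v by (simp add: We mult_mat_vec)
  also have "W *\<^sub>v v = (W * W) *\<^sub>v unit_vec (Suc n) 0"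
    unfolding We[symmetric] using W by (simp add: assoc_mult_mat_vec[of _ "Suc n" "Suc n" _ "Suc n"])
  also have "\<dots> = unit_vec (Suc n) 0" by (simp add: WW)
  finally have Be: "B *\<^sub>v unit_vec (Suc n) 0 = e \<cdot>\<^sub>v unit_vec (Suc n) 0" .
  have Bi0: "B $$ (i, 0) = (if i = 0 then e else 0)" if "i < Suc n" for i
  proof -
    have "vec_index (B *\<^sub>v unit_vec (Suc n) 0) i = vec_index (e \<cdot>\<^sub>v unit_vec (Suc n) 0) i"
      by (simp add: Be)
    then show ?thesis using that B by (simp split: if_splits)
  qed
  have symB: "B $$ (i, j) = B $$ (j, i)" if "i < Suc n" "j < Suc n" for i j
    using that B by (metis tB carrier_matD index_transpose_mat(1))
  have B0j: "B $$ (0, j) = (if j = 0 then e else 0)" if "j < Suc n" for j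
    using Bi0[OF that] symB[of 0 j] that by simp
  define C where "C = mat n n (\<lambda>(i, j). B $$ (Suc i, Suc j))"
  have C: "C \<in> carrier_mat n n" by (simp add: C_def)
  \<comment> \<open>The block form lets the diagonalization of \<open>C\<close> be bordered by the
    eigenvalue \<open>e\<close>.\<close>
  have BC: "B = four_block_mat (mat 1 1 (\<lambda>_. e)) (0\<^sub>m 1 n) (0\<^sub>m n 1) C"
    by (rule eq_matI) (use B Bi0 B0j in \<open>auto simp: C_def\<close>)
  have "transpose_mat C = C"
    by (rule eq_matI) (auto simp: C_def symB)
  from Suc.IH[OF C this] obtain U' D' where U': "U' \<in> carrier_mat n n" and D': "D' \<in> carrier_mat n n"
    and UU': "transpose_mat U' * U' = 1\<^sub>m n" and dD': "diagonal_mat D'" and CU: "C * U' = U' * D'"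
    by blast
  define E where "E = four_block_mat (1\<^sub>m 1) (0\<^sub>m 1 n) (0\<^sub>m n 1) U'"
  define D where "D = four_block_mat (mat 1 1 (\<lambda>_. e)) (0\<^sub>m 1 n) (0\<^sub>m n 1) D'"
  have E: "E \<in> carrier_mat (Suc n) (Suc n)" using U' by (auto simp: E_def)
  have D: "D \<in> carrier_mat (Suc n) (Suc n)" using D' by (auto simp: D_def)
  have "transpose_mat E * E = 1\<^sub>m (Suc n)"
    unfolding E_def using U'
    apply (subst transpose_four_block_mat[of _ 1 1 _ n _ n])
        apply auto[4]
    apply (subst mult_four_block_mat[of _ 1 1 _ n _ n _ _ 1 _ n])
            apply (auto simp: UU')
    done
  have dD: "diagonal_mat D"
    using D' dD' by (auto simp: D_def diagonal_mat_def)
  have BE: "B * E = E * D"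
    unfolding BC E_def D_def using U' C D'
    apply (subst mult_four_block_mat[of _ 1 1 _ n _ n _ _ 1 _ n])
            apply auto[6]
    apply (subst mult_four_block_mat[of _ 1 1 _ n _ n _ _ 1 _ n])
            apply (auto simp: CU)
    done
  define U where "U = W * E"
  have U: "U \<in> carrier_mat (Suc n) (Suc n)" using W E by (simp add: U_def)
  have "transpose_mat U * U = transpose_mat E * (W * W) * E"
    unfolding U_def using W E
    by (simp add: transpose_mult[of _ "Suc n" "Suc n" _ "Suc n"] tW assoc_mult_mat[of _ "Suc n" "Suc n" _ "Suc n" _ "Suc n"])
  also have "\<dots> = 1\<^sub>m (Suc n)"
    using E WW \<open>transpose_mat E * E = 1\<^sub>m (Suc n)\<close> by simp
  finally have UU: "transpose_mat U * U = 1\<^sub>m (Suc n)" .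
  have "A * U = (W * W) * A * (W * E)"
    using A by (simp add: WW U_def)
  also have "\<dots> = W * (B * E)"
    unfolding B_def using W A E by (simp add: assoc_mult_mat[of _ "Suc n" "Suc n" _ "Suc n" _ "Suc n"])
  also have "\<dots> = U * D"
    unfolding BE U_def using W E D by (simp add: assoc_mult_mat[of _ "Suc n" "Suc n" _ "Suc n" _ "Suc n"])
  finally show ?case
    using U D UU dD by blast
qed

lemma proots_prod_linear_factors:
  fixes xs :: "'a :: idom list"
  shows "proots (\<Prod>x\<leftarrow>xs. [:- x, 1:]) = mset xs"
proof (induction xs)
  case (Cons x xs)
  have "(\<Prod>x\<leftarrow>xs. [:- x, 1:]) \<noteq> 0" by (auto simp: prod_list_zero_iff)
  then have "proots ([:- x, 1:] * (\<Prod>x\<leftarrow>xs. [:- x, 1:])) = proots [:- x, 1:] + proots (\<Prod>x\<leftarrow>xs. [:- x, 1:])"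
    by (intro proots_mult) auto
  then show ?case
    unfolding Cons.IH list.map prod_list.Cons proots_linear_factor by simp
qed simp

text \<open>Diagonalization lists the eigenvalues in no particular order, while \<open>es\<close>
  lists them decreasingly. Both have the same multiset of entries, so permuting the columns of
  \<open>U\<close> by \<open>p\<close> aligns them. Orthonormality is recorded for vectors and for
  coordinates, the latter being completeness.\<close>

lemma orthonormal_eigenbasis:
  fixes a :: "nat \<Rightarrow> nat \<Rightarrow> real"
  assumes sym: "\<And>i j. i < n \<Longrightarrow> j < n \<Longrightarrow> a i j = a j i"
  defines "es \<equiv> rev (sorted_list_of_multiset (proots (char_poly (mat n n (\<lambda>(i, j). a i j)))))"
  shows "length es = n \<and>
    (\<exists>u :: nat \<Rightarrow> nat \<Rightarrow> real.
      (\<forall>i<n. \<forall>j<n. (\<Sum>k<n. u i k * u j k) = (if i = j then 1 else 0)) \<and>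
      (\<forall>k<n. \<forall>l<n. (\<Sum>i<n. u i k * u i l) = (if k = l then 1 else 0)) \<and>
      (\<forall>i<n. \<forall>k<n. (\<Sum>l<n. a k l * u i l) = es ! i * u i k))"
proof -
  define A where "A = mat n n (\<lambda>(i, j). a i j)"
  have A: "A \<in> carrier_mat n n" by (simp add: A_def)
  have tA: "transpose_mat A = A"
    by (rule eq_matI) (auto simp: A_def sym)
  obtain U D where U: "U \<in> carrier_mat n n" and D: "D \<in> carrier_mat n n"
    and UU: "transpose_mat U * U = 1\<^sub>m n" and dD: "diagonal_mat D" and AU: "A * U = U * D"
    using symmetric_diagonalizable[OF A tA] by blast
  have tU: "transpose_mat U \<in> carrier_mat n n" using U by simp
  have UU': "U * transpose_mat U = 1\<^sub>m n"
    using mat_mult_left_right_inverse[OF tU U UU] .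
  have "A = A * (U * transpose_mat U)" using A UU' by simp
  also have "\<dots> = U * D * transpose_mat U"
    using A U D tU by (simp add: AU[symmetric] assoc_mult_mat[of _ n n _ n _ n])
  finally have sim: "similar_mat A D"
    using A U D tU UU UU' by (intro similar_matI[where P = U and Q = "transpose_mat U" and n = n]) auto
  have "upper_triangular D" using dD D by (auto simp: diagonal_mat_def upper_triangular_def)
  then have "char_poly A = (\<Prod>d\<leftarrow>diag_mat D. [:- d, 1:])"
    using char_poly_similar[OF sim] char_poly_upper_triangular[OF D] by simp
  then have "proots (char_poly A) = mset (diag_mat D)"
    by (simp add: proots_prod_linear_factors)
  then have ms: "mset es = mset (diag_mat D)"
    by (simp add: es_def A_def)
  then obtain p where p: "p permutes {..<length (diag_mat D)}" "permute_list p (diag_mat D) = es"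
    using mset_eq_permutation by blast
  have len: "length (diag_mat D) = n" using D by (simp add: diag_mat_def)
  then have p': "p permutes {..<n}" using p by simp
  have les: "length es = n" using ms len by (metis mset_eq_length)
  have pn: "p i < n" if "i < n" for i using p' that permutes_in_image[of p "{..<n}" i] by simp
  have pinj: "p i = p j \<longleftrightarrow> i = j" for i j using permutes_inj[OF p'] by (auto dest: injD)
  have esi: "es ! i = D $$ (p i, p i)" if "i < n" for i
    using that p pn[OF that] len D by (auto simp: permute_list_def diag_mat_def)
  define u where "u i k = U $$ (k, p i)" for i k
  have 1: "(\<Sum>k<n. u i k * u j k) = (if i = j then 1 else 0)" if "i < n" "j < n" for i j
  proof -
    have "(\<Sum>k<n. u i k * u j k) = (transpose_mat U * U) $$ (p i, p j)"
      using that U pn by (simp add: u_def scalar_prod_def atLeast0LessThan)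
    then show ?thesis using that pn by (simp add: UU pinj)
  qed
  have 2: "(\<Sum>i<n. u i k * u i l) = (if k = l then 1 else 0)" if "k < n" "l < n" for k l
  proof -
    have "(\<Sum>i<n. u i k * u i l) = (\<Sum>i<n. U $$ (k, i) * U $$ (l, i))"
      unfolding u_def using sum.permute[OF p', of "\<lambda>i. U $$ (k, i) * U $$ (l, i)"] by (simp add: o_def)
    also have "\<dots> = (U * transpose_mat U) $$ (k, l)"
      using that U by (simp add: scalar_prod_def atLeast0LessThan)
    finally show ?thesis using that by (simp add: UU')
  qed
  have 3: "(\<Sum>l<n. a k l * u i l) = es ! i * u i k" if "i < n" "k < n" for i k
  proof -
    have "(\<Sum>l<n. a k l * u i l) = (A * U) $$ (k, p i)"
      using that U pn by (simp add: u_def A_def scalar_prod_def atLeast0LessThan)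
    also have "\<dots> = (\<Sum>l<n. U $$ (k, l) * D $$ (l, p i))"
      unfolding AU using that U D pn by (simp add: scalar_prod_def atLeast0LessThan)
    also have "\<dots> = (\<Sum>l<n. if l = p i then U $$ (k, l) * D $$ (l, p i) else 0)"
      using dD D pn[OF that(1)] by (intro sum.cong) (auto simp: diagonal_mat_def)
    also have "\<dots> = es ! i * u i k"
      using that pn by (simp add: esi u_def)
    finally show ?thesis .
  qed
  show ?thesis using les 1 2 3 by blast
qed

section \<open>Second eigenvalue of a reversible kernel\<close>

lemma symmetric_form_swap:
  fixes a :: "nat \<Rightarrow> nat \<Rightarrow> real"
  assumes sym: "\<And>i j. i < n \<Longrightarrow> j < n \<Longrightarrow> a i j = a j i"
  shows "(\<Sum>k<n. (\<Sum>l<n. a k l * g l) * h k) = (\<Sum>k<n. g k * (\<Sum>l<n. a k l * h l))"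
proof -
  have "(\<Sum>k<n. (\<Sum>l<n. a k l * g l) * h k) = (\<Sum>k<n. \<Sum>l<n. a k l * g l * h k)"
    by (simp add: sum_distrib_right)
  also have "\<dots> = (\<Sum>l<n. \<Sum>k<n. a k l * g l * h k)" by (rule sum.swap)
  also have "\<dots> = (\<Sum>k<n. g k * (\<Sum>l<n. a k l * h l))"
    unfolding sum_distrib_left by (intro sum.cong refl) (auto simp: sym algebra_simps)
  finally show ?thesis .
qed

text \<open>Courant-Fischer for a form whose top eigenvalue 1 is attained at a known vector
  \<open>s\<close>: \<open>e\<close> is the maximal Rayleigh quotient on the orthogonal complement
  of \<open>s\<close>. The second claim is the upper bound, the third provides a vector that attains
  at least \<open>e\<close>.\<close>

lemma symmetric_second_eigenvalue:
  fixes a :: "nat \<Rightarrow> nat \<Rightarrow> real"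
  assumes n: "n \<ge> 2"
    and sym: "\<And>i j. i < n \<Longrightarrow> j < n \<Longrightarrow> a i j = a j i"
    and s: "\<And>k. k < n \<Longrightarrow> (\<Sum>l<n. a k l * s l) = s k" "(\<Sum>k<n. (s k)\<^sup>2) > 0"
    and contr: "\<And>g. (\<Sum>k<n. g k * (\<Sum>l<n. a k l * g l)) \<le> (\<Sum>k<n. (g k)\<^sup>2)"
  defines "e \<equiv> rev (sorted_list_of_multiset (proots (char_poly (mat n n (\<lambda>(i, j). a i j))))) ! 1"
  shows "e \<le> 1"
    and "(\<Sum>k<n. s k * g k) = 0 \<Longrightarrow> (\<Sum>k<n. g k * (\<Sum>l<n. a k l * g l)) \<le> e * (\<Sum>k<n. (g k)\<^sup>2)"
    and "\<exists>g. (\<Sum>k<n. s k * g k) = 0 \<and> (\<Sum>k<n. (g k)\<^sup>2) > 0 \<and>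
           e * (\<Sum>k<n. (g k)\<^sup>2) \<le> (\<Sum>k<n. g k * (\<Sum>l<n. a k l * g l))"
proof -
  define es where "es = rev (sorted_list_of_multiset (proots (char_poly (mat n n (\<lambda>(i, j). a i j)))))"
  have e: "e = es ! 1" by (simp add: e_def es_def)
  obtain u :: "nat \<Rightarrow> nat \<Rightarrow> real" where len: "length es = n"
    and orth: "\<And>i j. i < n \<Longrightarrow> j < n \<Longrightarrow> (\<Sum>k<n. u i k * u j k) = (if i = j then 1 else 0)"
    and comp: "\<And>k l. k < n \<Longrightarrow> l < n \<Longrightarrow> (\<Sum>i<n. u i k * u i l) = (if k = l then 1 else 0)"
    and eig: "\<And>i k. i < n \<Longrightarrow> k < n \<Longrightarrow> (\<Sum>l<n. a k l * u i l) = es ! i * u i k"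
    using orthonormal_eigenbasis[of n a, OF sym] unfolding es_def[symmetric] by blast
  have mono: "es ! j \<le> es ! i" if "i \<le> j" "j < n" for i j
    by (rule sorted_rev_nth_mono) (use that len in \<open>auto simp: es_def\<close>)
  define c where "c g i = (\<Sum>k<n. u i k * g k)" for g i
  have expand: "g k = (\<Sum>i<n. c g i * u i k)" if "k < n" for g k
  proof -
    have "(\<Sum>i<n. c g i * u i k) = (\<Sum>i<n. \<Sum>l<n. u i l * g l * u i k)"
      by (simp add: c_def sum_distrib_right)
    also have "\<dots> = (\<Sum>l<n. \<Sum>i<n. u i l * g l * u i k)" by (rule sum.swap)
    also have "\<dots> = (\<Sum>l<n. g l * (\<Sum>i<n. u i l * u i k))"
      by (simp add: sum_distrib_left algebra_simps)
    also have "\<dots> = g k" using that by (simp add: comp if_distrib cong: if_cong)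
    finally show ?thesis by simp
  qed
  have parseval: "(\<Sum>k<n. g k * h k) = (\<Sum>i<n. c g i * c h i)" for g h
  proof -
    have "(\<Sum>k<n. g k * h k) = (\<Sum>k<n. (\<Sum>i<n. c g i * u i k) * h k)"
      using expand by (intro sum.cong) auto
    also have "\<dots> = (\<Sum>k<n. \<Sum>i<n. c g i * (u i k * h k))"
      by (simp add: sum_distrib_right mult.assoc)
    also have "\<dots> = (\<Sum>i<n. \<Sum>k<n. c g i * (u i k * h k))" by (rule sum.swap)
    finally show ?thesis by (simp add: c_def sum_distrib_left)
  qed
  have cA: "c (\<lambda>k. \<Sum>l<n. a k l * g l) i = es ! i * c g i" if "i < n" for g i
  proof -
    have "c (\<lambda>k. \<Sum>l<n. a k l * g l) i = (\<Sum>k<n. (\<Sum>l<n. a k l * g l) * u i k)"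
      by (simp add: c_def mult.commute)
    also have "\<dots> = (\<Sum>k<n. g k * (\<Sum>l<n. a k l * u i l))"
      using sym by (rule symmetric_form_swap[where h = "u i"]) auto
    also have "\<dots> = (\<Sum>k<n. g k * (es ! i * u i k))"
      using that by (intro sum.cong refl) (simp add: eig)
    finally show ?thesis by (simp add: c_def sum_distrib_left algebra_simps)
  qed
  have form: "(\<Sum>k<n. g k * (\<Sum>l<n. a k l * g l)) = (\<Sum>i<n. es ! i * (c g i)\<^sup>2)" for g
    unfolding parseval[of g "\<lambda>k. \<Sum>l<n. a k l * g l"]
    by (intro sum.cong) (auto simp: cA power2_eq_square)
  have sq: "(\<Sum>k<n. (g k)\<^sup>2) = (\<Sum>i<n. (c g i)\<^sup>2)" for g
    using parseval[of g g] by (simp add: power2_eq_square)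
  have cu: "c (u i) j = (if j = i then 1 else 0)" if "i < n" "j < n" for i j
    using orth[OF that(2,1)] by (simp add: c_def)
  have "es ! 1 \<le> 1"
  proof -
    have "(\<Sum>i<n. es ! i * (c (u 1) i)\<^sup>2) \<le> (\<Sum>i<n. (c (u 1) i)\<^sup>2)"
      using contr[of "u 1"] form[of "u 1"] sq[of "u 1"] by simp
    moreover have "(\<Sum>i<n. es ! i * (c (u 1) i)\<^sup>2) = (\<Sum>i<n. if i = 1 then es ! i else 0)"
      using n by (intro sum.cong) (auto simp: cu)
    moreover have "(\<Sum>i<n. (c (u 1) i)\<^sup>2) = (\<Sum>i<n. if i = 1 then 1 else 0)"
      using n by (intro sum.cong) (auto simp: cu)
    ultimately show ?thesis using n by simp
  qed
  then show e1: "e \<le> 1" by (simp add: e)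
  define d where "d = c s"
  have ed: "es ! i * d i = d i" if "i < n" for i
  proof -
    have "c (\<lambda>k. \<Sum>l<n. a k l * s l) i = c s i"
      unfolding c_def using s(1) by (intro sum.cong) auto
    then show ?thesis using cA[OF that, of s] by (simp add: d_def)
  qed
  show "(\<Sum>k<n. g k * (\<Sum>l<n. a k l * g l)) \<le> e * (\<Sum>k<n. (g k)\<^sup>2)" if g: "(\<Sum>k<n. s k * g k) = 0"
  \<comment> \<open>If 1 is a multiple eigenvalue, \<open>s\<close> need not be proportional to
    \<open>u 0\<close>, but then the bound is just \<open>contr\<close>.\<close>
  proof (cases "e = 1")
    case True
    then show ?thesis using contr[of g] by simp
  next
    case False
    then have lt: "e < 1" using e1 by simp
    \<comment> \<open>All eigenvalues from index 1 on are below 1, while \<open>s\<close> has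
      eigenvalue 1, so \<open>s\<close> has no component along them. Orthogonality to
      \<open>s\<close> thus means orthogonality to \<open>u 0\<close>.\<close>
    have d0: "d i = 0" if "i < n" "i \<noteq> 0" for i
      using ed[OF that(1)] mono[of 1 i] that lt e by auto
    have "(\<Sum>i<n. (d i)\<^sup>2) = (\<Sum>i<n. if i = 0 then (d 0)\<^sup>2 else 0)"
      using d0 by (intro sum.cong) auto
    then have "d 0 \<noteq> 0" using s(2) n by (simp add: sq[of s] d_def)
    moreover have "(\<Sum>i<n. d i * c g i) = (\<Sum>i<n. if i = 0 then d 0 * c g 0 else 0)"
      using d0 by (intro sum.cong) auto
    then have "d 0 * c g 0 = 0" using g n by (simp add: parseval[of s g] d_def)
    ultimately have c0: "c g 0 = 0" by simp
    have "(\<Sum>i<n. es ! i * (c g i)\<^sup>2) \<le> (\<Sum>i<n. e * (c g i)\<^sup>2)"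
    proof (rule sum_mono)
      fix i assume "i \<in> {..<n}"
      then show "es ! i * (c g i)\<^sup>2 \<le> e * (c g i)\<^sup>2"
        using mono[of 1 i] c0 by (cases "i = 0") (auto simp: e intro: mult_right_mono)
    qed
    then show ?thesis unfolding form sq[of g] by (simp only: sum_distrib_left)
  qed
  \<comment> \<open>The plane spanned by \<open>u 0\<close> and \<open>u 1\<close> meets the
    complement of \<open>s\<close> in a nonzero vector, and on that plane the Rayleigh quotient is
    at least \<open>es ! 1\<close>.\<close>
  obtain \<alpha> \<beta> where ab: "\<alpha> * d 0 + \<beta> * d 1 = 0" "\<alpha> \<noteq> 0 \<or> \<beta> \<noteq> 0"
  proof (cases "d 0 = 0")
    case True
    then show thesis using that[of 1 0] by simp
  next
    case False
    then show thesis using that[of "d 1" "- d 0"] by simp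
  qed
  define g where "g k = \<alpha> * u 0 k + \<beta> * u 1 k" for k
  have cg: "c g i = (if i = 0 then \<alpha> else if i = 1 then \<beta> else 0)" if "i < n" for i
  proof -
    have "c g i = \<alpha> * c (u 0) i + \<beta> * c (u 1) i"
      by (simp add: c_def g_def sum_distrib_left sum.distrib algebra_simps)
    then show ?thesis using that n cu[of 0 i] cu[of 1 i] by simp
  qed
  have two: "(\<Sum>i<n. h i) = h 0 + h 1" if "\<And>i. i < n \<Longrightarrow> i \<noteq> 0 \<Longrightarrow> i \<noteq> 1 \<Longrightarrow> h i = 0" for h :: "nat \<Rightarrow> real"
  proof -
    have "sum h {0, 1} = (\<Sum>i<n. h i)"
      by (rule sum.mono_neutral_left) (use n that in auto)
    then show ?thesis by simp
  qed
  have n01: "0 < n" "1 < n" using n by auto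
  have "(\<Sum>k<n. s k * g k) = 0"
    unfolding parseval[of s g] using ab(1) n01 by (subst two) (auto simp: cg d_def[symmetric] algebra_simps)
  moreover have sqg: "(\<Sum>k<n. (g k)\<^sup>2) = \<alpha>\<^sup>2 + \<beta>\<^sup>2"
    unfolding sq[of g] using n01 by (subst two) (auto simp: cg)
  moreover have "\<alpha>\<^sup>2 + \<beta>\<^sup>2 > 0" using ab(2) by (simp add: sum_power2_gt_zero_iff)
  moreover have "(\<Sum>k<n. g k * (\<Sum>l<n. a k l * g l)) = es ! 0 * \<alpha>\<^sup>2 + e * \<beta>\<^sup>2"
    unfolding form using n01 by (subst two) (auto simp: cg e)
  moreover have "e * \<alpha>\<^sup>2 \<le> es ! 0 * \<alpha>\<^sup>2"
    using mono[of 0 1] n by (intro mult_right_mono) (auto simp: e)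
  ultimately show "\<exists>g. (\<Sum>k<n. s k * g k) = 0 \<and> (\<Sum>k<n. (g k)\<^sup>2) > 0 \<and>
           e * (\<Sum>k<n. (g k)\<^sup>2) \<le> (\<Sum>k<n. g k * (\<Sum>l<n. a k l * g l))"
    by (intro exI[of _ g]) (auto simp: algebra_simps)
qed

lemma sum_enum_of:
  assumes "finite S"
  shows "sum h S = (\<Sum>i<card S. h (enum_of S ! i))"
proof -
  have "bij_betw ((!) (enum_of S)) {..<card S} S"
    by (rule bij_betw_nth) (use enum_of[OF assms] in auto)
  then show ?thesis by (rule sum.reindex_bij_betw[symmetric])
qed

text \<open>Detailed balance makes \<open>P\<close> symmetric after conjugation by the diagonal
  matrix of \<open>sqrt p\<close>. The substitution \<open>g = s * f\<close> turns sums weighted by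
  \<open>p\<close> into plain ones, and the constant function into the eigenvector
  \<open>s\<close>.\<close>

lemma reversible_second_eigenvalue:
  fixes P :: "'a \<Rightarrow> 'a \<Rightarrow> real" and p :: "'a \<Rightarrow> real"
  assumes S: "finite S" "card S \<ge> 2"
    and p: "\<And>x. x \<in> S \<Longrightarrow> p x > 0"
    and rev: "\<And>x y. x \<in> S \<Longrightarrow> y \<in> S \<Longrightarrow> p x * P x y = p y * P y x"
    and one: "\<And>x. x \<in> S \<Longrightarrow> (\<Sum>y\<in>S. P x y) = 1"
    and contr: "\<And>f. (\<Sum>x\<in>S. p x * f x * (\<Sum>y\<in>S. P x y * f y)) \<le> (\<Sum>x\<in>S. p x * (f x)\<^sup>2)"
  defines "e \<equiv> second_eigenvalue_on S P"
  shows "e \<le> 1"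
    and "(\<Sum>x\<in>S. p x * f x) = 0 \<Longrightarrow>
           (\<Sum>x\<in>S. p x * f x * (\<Sum>y\<in>S. P x y * f y)) \<le> e * (\<Sum>x\<in>S. p x * (f x)\<^sup>2)"
    and "\<exists>f. (\<Sum>x\<in>S. p x * f x) = 0 \<and> (\<Sum>x\<in>S. p x * (f x)\<^sup>2) > 0 \<and>
           e * (\<Sum>x\<in>S. p x * (f x)\<^sup>2) \<le> (\<Sum>x\<in>S. p x * f x * (\<Sum>y\<in>S. P x y * f y))"
proof -
  define n where "n = card S"
  define x where "x = (!) (enum_of S)"
  have xS: "x i \<in> S" if "i < n" for i
    using that nth_mem[of i "enum_of S"] unfolding x_def n_def enum_of(2,3)[OF S(1)] by simp
  have bij: "bij_betw x {..<n} S"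
    unfolding x_def n_def
    by (rule bij_betw_nth) (use enum_of[OF S(1)] in auto)
  define s where "s i = sqrt (p (x i))" for i
  have spos: "s i > 0" if "i < n" for i using p[OF xS[OF that]] by (simp add: s_def)
  have sne: "s i \<noteq> 0" if "i < n" for i using spos[OF that] by simp
  have ss: "s i * s i = p (x i)" if "i < n" for i using p[OF xS[OF that]] by (simp add: s_def)
  define a where "a i j = s i * P (x i) (x j) / s j" for i j
  have sym: "a i j = a j i" if "i < n" "j < n" for i j
  proof -
    have "s i * s i * P (x i) (x j) = s j * s j * P (x j) (x i)"
      using rev[OF xS xS] that ss by simp
    then show ?thesis using spos[OF that(1)] spos[OF that(2)] by (simp add: a_def field_simps)
  qed
  have sumS: "sum h S = (\<Sum>i<n. h (x i))" for h :: "'a \<Rightarrow> real"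
    unfolding n_def x_def by (rule sum_enum_of[OF S(1)])
  have s1: "(\<Sum>l<n. a k l * s l) = s k" if "k < n" for k
  proof -
    have "(\<Sum>l<n. a k l * s l) = (\<Sum>l<n. s k * P (x k) (x l))"
      by (intro sum.cong) (auto simp: a_def sne)
    also have "\<dots> = s k" using one[OF xS[OF that]] by (simp add: sumS sum_distrib_left[symmetric])
    finally show ?thesis .
  qed
  have s2: "(\<Sum>k<n. (s k)\<^sup>2) > 0"
    by (rule sum_pos2[of _ 0]) (use sne[of 0] S in \<open>auto simp: n_def\<close>)
  have form: "(\<Sum>k<n. s k * f (x k) * (\<Sum>l<n. a k l * (s l * f (x l))))
      = (\<Sum>x\<in>S. p x * f x * (\<Sum>y\<in>S. P x y * f y))" for f
  proof -
    have "(\<Sum>l<n. a k l * (s l * f (x l))) = s k * (\<Sum>l<n. P (x k) (x l) * f (x l))" for k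
      unfolding sum_distrib_left by (intro sum.cong) (auto simp: a_def sne)
    then show ?thesis
      unfolding sumS using ss by (intro sum.cong) (auto simp: algebra_simps)
  qed
  have sq: "(\<Sum>k<n. (s k * f (x k))\<^sup>2) = (\<Sum>x\<in>S. p x * (f x)\<^sup>2)" for f
    unfolding sumS by (intro sum.cong) (auto simp: ss[symmetric] power2_eq_square)
  have mean: "(\<Sum>k<n. s k * (s k * f (x k))) = (\<Sum>x\<in>S. p x * f x)" for f
    unfolding sumS by (intro sum.cong) (auto simp: ss[symmetric])
  \<comment> \<open>Inverse of the substitution \<open>g = s * f\<close>; it carries arbitrary
    vectors, in particular the extremal one, back to functions on \<open>S\<close>.\<close>
  define pull where "pull g y = g (the_inv_into {..<n} x y) / s (the_inv_into {..<n} x y)" for g y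
  have pull: "s k * pull g (x k) = g k" if "k < n" for g k
    using that bij spos[OF that] by (simp add: pull_def bij_betw_def the_inv_into_f_f)
  have formb: "(\<Sum>k<n. g k * (\<Sum>l<n. a k l * g l))
      = (\<Sum>x\<in>S. p x * pull g x * (\<Sum>y\<in>S. P x y * pull g y))" for g
    unfolding form[symmetric] by (intro sum.cong) (auto simp: pull)
  have sqb: "(\<Sum>k<n. (g k)\<^sup>2) = (\<Sum>x\<in>S. p x * (pull g x)\<^sup>2)" for g
    unfolding sq[symmetric] by (intro sum.cong) (auto simp: pull)
  have meanb: "(\<Sum>k<n. s k * g k) = (\<Sum>x\<in>S. p x * pull g x)" for g
    unfolding mean[symmetric] by (intro sum.cong) (auto simp: pull)
  have contr': "(\<Sum>k<n. g k * (\<Sum>l<n. a k l * g l)) \<le> (\<Sum>k<n. (g k)\<^sup>2)" for g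
    unfolding formb sqb by (rule contr)
  \<comment> \<open>\<open>Q\<close> is the diagonal matrix of \<open>s\<close> and \<open>R\<close>
    its inverse. Similarity preserves the characteristic polynomial, so \<open>e\<close> can be read
    off from the symmetric matrix.\<close>
  define A where "A = mat n n (\<lambda>(i, j). a i j)"
  define Q where "Q = mat n n (\<lambda>(i, j). if i = j then s i else 0)"
  define R where "R = mat n n (\<lambda>(i, j). if i = j then 1 / s i else 0)"
  have carr: "A \<in> carrier_mat n n" "Q \<in> carrier_mat n n" "R \<in> carrier_mat n n" "mat_on S P \<in> carrier_mat n n"
    by (auto simp: A_def Q_def R_def mat_on_def n_def)
  have "R * Q = 1\<^sub>m n"
    by (intro eq_matI) (auto simp: R_def Q_def scalar_prod_def sne if_distrib[of "\<lambda>x. x * _"] cong: if_cong)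
  moreover have "Q * R = 1\<^sub>m n"
    by (intro eq_matI) (auto simp: R_def Q_def scalar_prod_def sne if_distrib[of "\<lambda>x. x * _"] cong: if_cong)
  moreover have "mat_on S P = R * A * Q"
  proof (rule eq_matI)
    fix i j assume "i < dim_row (R * A * Q)" "j < dim_col (R * A * Q)"
    then have ij: "i < n" "j < n" using carr by auto
    have RA: "(R * A) $$ (i, k) = P (x i) (x k) / s k" if "k < n" for k
    proof -
      have "(R * A) $$ (i, k) = (\<Sum>l<n. R $$ (i, l) * A $$ (l, k))"
        using ij that carr by (simp add: scalar_prod_def atLeast0LessThan)
      also have "\<dots> = (\<Sum>l<n. if l = i then P (x i) (x k) / s k else 0)"
        using ij that by (intro sum.cong) (auto simp: R_def A_def a_def sne)
      finally show ?thesis using ij by simp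
    qed
    have "(M * Q) $$ (i, j) = (\<Sum>k<n. M $$ (i, k) * Q $$ (k, j))" if "M \<in> carrier_mat n n" for M
      using ij carr that by (simp add: scalar_prod_def atLeast0LessThan)
    then have "(R * A * Q) $$ (i, j) = (\<Sum>k<n. (R * A) $$ (i, k) * Q $$ (k, j))"
      using carr(1,3) mult_carrier_mat by blast
    also have "\<dots> = (\<Sum>k<n. if k = j then P (x i) (x j) else 0)"
      using ij by (intro sum.cong) (auto simp: RA Q_def sne)
    also have "\<dots> = mat_on S P $$ (i, j)"
      using ij by (simp add: mat_on_def x_def n_def)
    finally show "mat_on S P $$ (i, j) = (R * A * Q) $$ (i, j)" by simp
  qed (use carr in auto)
  ultimately have "similar_mat (mat_on S P) A"
    using carr by (intro similar_matI[where P = R and Q = Q and n = n]) auto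
  then have "char_poly (mat_on S P) = char_poly A" by (rule char_poly_similar)
  then have e: "e = rev (sorted_list_of_multiset (proots (char_poly (mat n n (\<lambda>(i, j). a i j))))) ! 1"
    by (simp add: e_def second_eigenvalue_on_def A_def)
  have n: "n \<ge> 2" using S by (simp add: n_def)
  note main = symmetric_second_eigenvalue[where n = n and a = a and s = s, OF n sym s1 s2 contr', folded e]
  show "e \<le> 1" using main(1) .
  show "(\<Sum>x\<in>S. p x * f x * (\<Sum>y\<in>S. P x y * f y)) \<le> e * (\<Sum>x\<in>S. p x * (f x)\<^sup>2)"
    if "(\<Sum>x\<in>S. p x * f x) = 0"
    using main(2)[of "\<lambda>k. s k * f (x k)"] that unfolding mean form sq by blast
  show "\<exists>f. (\<Sum>x\<in>S. p x * f x) = 0 \<and> (\<Sum>x\<in>S. p x * (f x)\<^sup>2) > 0 \<and>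
           e * (\<Sum>x\<in>S. p x * (f x)\<^sup>2) \<le> (\<Sum>x\<in>S. p x * f x * (\<Sum>y\<in>S. P x y * f y))"
    using main(3) unfolding meanb formb sqb by blast
qed

section \<open>Dirichlet form and spectral gap of the Glauber dynamics\<close>

definition cond_mean :: "'a pmf \<Rightarrow> ('a \<Rightarrow> 'b) \<Rightarrow> ('a \<Rightarrow> real) \<Rightarrow> 'a \<Rightarrow> real" where
  "cond_mean p k f x = (\<Sum>y\<in>set_pmf p. pmf (cond_pmf p {y. k y = k x}) y * f y)"

context
  fixes p :: "'a pmf" and k :: "'a \<Rightarrow> 'b"
  assumes fin: "finite (set_pmf p)"
begin

lemma pmf_cond_fibre:
  assumes "x \<in> set_pmf p"
  shows "pmf (cond_pmf p {y. k y = k x}) y =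
    (if k y = k x then pmf p y / measure_pmf.prob p {y. k y = k x} else 0)"
  using assms by (subst pmf_cond) auto

lemma cond_fibre_reversible:
  assumes "x \<in> set_pmf p" "y \<in> set_pmf p"
  shows "pmf p x * pmf (cond_pmf p {z. k z = k x}) y = pmf p y * pmf (cond_pmf p {z. k z = k y}) x"
  using assms by (simp add: pmf_cond_fibre)

lemma sum_cond_fibre:
  assumes "x \<in> set_pmf p"
  shows "(\<Sum>y\<in>set_pmf p. pmf (cond_pmf p {y. k y = k x}) y) = 1"
proof (rule sum_pmf_eq_1[OF fin])
  show "set_pmf (cond_pmf p {y. k y = k x}) \<subseteq> set_pmf p"
    using assms by (subst set_cond_pmf) auto
qed

lemma cond_mean_fibre: "k x = k y \<Longrightarrow> cond_mean p k f x = cond_mean p k f y"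
  by (simp add: cond_mean_def)

text \<open>The defining property of conditional expectation. Resampling inside a fibre of
  \<open>k\<close> is reversible, so the roles of \<open>x\<close> and \<open>y\<close> in the
  double sum can be exchanged; \<open>g\<close> is constant on fibres and follows along.\<close>

lemma sum_mult_cond_mean:
  assumes g: "\<And>x y. k x = k y \<Longrightarrow> g x = g y"
  shows "(\<Sum>x\<in>set_pmf p. pmf p x * (g x * cond_mean p k f x)) = (\<Sum>x\<in>set_pmf p. pmf p x * (g x * f x))"
proof -
  let ?K = "\<lambda>x y. pmf (cond_pmf p {z. k z = k x}) y"
  have "(\<Sum>x\<in>set_pmf p. pmf p x * (g x * cond_mean p k f x))
      = (\<Sum>x\<in>set_pmf p. \<Sum>y\<in>set_pmf p. (pmf p x * ?K x y) * (g x * f y))"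
    by (simp add: cond_mean_def sum_distrib_left algebra_simps)
  also have "\<dots> = (\<Sum>y\<in>set_pmf p. \<Sum>x\<in>set_pmf p. (pmf p x * ?K x y) * (g x * f y))"
    by (rule sum.swap)
  also have "\<dots> = (\<Sum>y\<in>set_pmf p. \<Sum>x\<in>set_pmf p. (pmf p y * ?K y x) * (g y * f y))"
  proof (intro sum.cong refl)
    fix x y assume "y \<in> set_pmf p" "x \<in> set_pmf p"
    then show "(pmf p x * ?K x y) * (g x * f y) = (pmf p y * ?K y x) * (g y * f y)"
      unfolding cond_fibre_reversible[OF \<open>x \<in> set_pmf p\<close> \<open>y \<in> set_pmf p\<close>]
      using g[of x y] by (cases "k x = k y") (auto simp: pmf_cond_fibre)
  qed
  also have "\<dots> = (\<Sum>y\<in>set_pmf p. pmf p y * (g y * f y) * (\<Sum>x\<in>set_pmf p. ?K y x))"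
    by (simp add: sum_distrib_left algebra_simps)
  also have "\<dots> = (\<Sum>x\<in>set_pmf p. pmf p x * (g x * f x))"
    by (intro sum.cong) (auto simp: sum_cond_fibre)
  finally show ?thesis .
qed

text \<open>Pythagoras: conditional expectation is an orthogonal projection, so the inner product of
  \<open>f\<close> with its projection is the squared norm of the projection.\<close>

lemma sum_cond_mean_residual:
  "(\<Sum>x\<in>set_pmf p. pmf p x * (f x - cond_mean p k f x)\<^sup>2)
    = (\<Sum>x\<in>set_pmf p. pmf p x * (f x)\<^sup>2) - (\<Sum>x\<in>set_pmf p. pmf p x * f x * cond_mean p k f x)"
proof -
  let ?h = "cond_mean p k f"
  have "(\<Sum>x\<in>set_pmf p. pmf p x * (f x - ?h x)\<^sup>2)
    = (\<Sum>x\<in>set_pmf p. pmf p x * (f x)\<^sup>2) - 2 * (\<Sum>x\<in>set_pmf p. pmf p x * f x * ?h x)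
      + (\<Sum>x\<in>set_pmf p. pmf p x * (?h x * ?h x))"
    unfolding sum_distrib_left sum_subtractf[symmetric] sum.distrib[symmetric]
    by (intro sum.cong) (auto simp: power2_eq_square algebra_simps)
  also have "(\<Sum>x\<in>set_pmf p. pmf p x * (?h x * ?h x)) = (\<Sum>x\<in>set_pmf p. pmf p x * f x * ?h x)"
    by (subst sum_mult_cond_mean[OF cond_mean_fibre]) (auto simp: algebra_simps)
  finally show ?thesis by simp
qed

text \<open>The residual of the projection is orthogonal to \<open>?d\<close>, the difference of two
  functions of \<open>k\<close>, so the cross term vanishes.\<close>

lemma cond_mean_minimises:
  assumes g: "\<And>x y. k x = k y \<Longrightarrow> g x = g y"
  shows "(\<Sum>x\<in>set_pmf p. pmf p x * (f x - cond_mean p k f x)\<^sup>2) \<le> (\<Sum>x\<in>set_pmf p. pmf p x * (f x - g x)\<^sup>2)"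
proof -
  let ?h = "cond_mean p k f"
  let ?d = "\<lambda>x. ?h x - g x"
  have d: "?d x = ?d y" if "k x = k y" for x y
    using that g cond_mean_fibre by metis
  have "(\<Sum>x\<in>set_pmf p. pmf p x * (f x - g x)\<^sup>2)
     = (\<Sum>x\<in>set_pmf p. pmf p x * (f x - ?h x)\<^sup>2) + (\<Sum>x\<in>set_pmf p. pmf p x * (?d x)\<^sup>2)
       + 2 * ((\<Sum>x\<in>set_pmf p. pmf p x * (?d x * f x)) - (\<Sum>x\<in>set_pmf p. pmf p x * (?d x * ?h x)))"
    unfolding sum_distrib_left sum_subtractf[symmetric] sum.distrib[symmetric]
    by (intro sum.cong) (auto simp: power2_eq_square algebra_simps)
  also have "(\<Sum>x\<in>set_pmf p. pmf p x * (?d x * ?h x)) = (\<Sum>x\<in>set_pmf p. pmf p x * (?d x * f x))"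
    by (rule sum_mult_cond_mean[OF d])
  finally show ?thesis
    by (simp add: sum_nonneg)
qed

lemma cond_mean_diff_const:
  "x \<in> set_pmf p \<Longrightarrow> cond_mean p k (\<lambda>x. f x - c) x = cond_mean p k f x - c"
  by (simp add: cond_mean_def algebra_simps sum_subtractf sum_distrib_left[symmetric] sum_cond_fibre)

end

section \<open>Mean, variance and Dirichlet form\<close>

definition mean :: "'a pmf \<Rightarrow> ('a \<Rightarrow> real) \<Rightarrow> real" where
  "mean p f = (\<Sum>x\<in>set_pmf p. pmf p x * f x)"

definition var :: "'a pmf \<Rightarrow> ('a \<Rightarrow> real) \<Rightarrow> real" where
  "var p f = mean p (\<lambda>x. (f x - mean p f)\<^sup>2)"

text \<open>The expected conditional variance at a uniformly chosen site given all other spins. By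
  \<open>dirichlet_eq\<close> this is the Dirichlet form of the Glauber chain; in this shape it is
  visibly nonnegative and easy to compare between distributions.\<close>

definition dirichlet :: "'v set \<Rightarrow> 'v config pmf \<Rightarrow> ('v config \<Rightarrow> real) \<Rightarrow> real" where
  "dirichlet V p f =
     (\<Sum>v\<in>V. mean p (\<lambda>\<sigma>. (f \<sigma> - cond_mean p (\<lambda>\<sigma>. restrict \<sigma> (V - {v})) f \<sigma>)\<^sup>2)) / card V"

lemma mean_nonneg: "(\<And>x. x \<in> set_pmf p \<Longrightarrow> f x \<ge> 0) \<Longrightarrow> mean p f \<ge> 0"
  unfolding mean_def by (intro sum_nonneg) auto

lemma var_nonneg: "var p f \<ge> 0"
  unfolding var_def by (intro mean_nonneg) auto

lemma dirichlet_nonneg: "dirichlet V p f \<ge> 0"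
  unfolding dirichlet_def by (intro divide_nonneg_nonneg sum_nonneg mean_nonneg) auto

lemma sum_set_pmf: "finite (set_pmf p) \<Longrightarrow> (\<Sum>x\<in>set_pmf p. pmf p x) = 1"
  by (rule sum_pmf_eq_1) auto

lemma var_eq:
  assumes "finite (set_pmf p)"
  shows "var p f = mean p (\<lambda>x. (f x)\<^sup>2) - (mean p f)\<^sup>2"
proof -
  let ?m = "mean p f"
  have "var p f = (\<Sum>x\<in>set_pmf p. pmf p x * (f x)\<^sup>2) - 2 * ?m * (\<Sum>x\<in>set_pmf p. pmf p x * f x)
      + ?m\<^sup>2 * (\<Sum>x\<in>set_pmf p. pmf p x)"
    unfolding var_def mean_def[of p "\<lambda>x. (f x - ?m)\<^sup>2"]
    unfolding sum_distrib_left sum_subtractf[symmetric] sum.distrib[symmetric]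
    by (intro sum.cong) (auto simp: power2_eq_square algebra_simps)
  then show ?thesis
    by (simp add: sum_set_pmf[OF assms] mean_def[symmetric] power2_eq_square)
qed

lemma mean_diff_const:
  assumes "finite (set_pmf p)"
  shows "mean p (\<lambda>x. f x - c) = mean p f - c"
  by (simp add: mean_def algebra_simps sum_subtractf sum_distrib_left[symmetric] sum_set_pmf[OF assms])

lemma dirichlet_diff_const:
  assumes "finite (set_pmf p)"
  shows "dirichlet V p (\<lambda>\<sigma>. f \<sigma> - c) = dirichlet V p f"
  unfolding dirichlet_def mean_def
  by (intro arg_cong2[of _ _ _ _ "(/)"] sum.cong refl) (simp add: cond_mean_diff_const[OF assms])

text \<open>A configuration of \<open>configs V\<close> is \<open>undefined\<close> outside
  \<open>V\<close>, so it is determined by its spin at \<open>v\<close> and its restriction to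
  \<open>V - {v}\<close>. Resampling one spin is therefore the same as drawing a whole configuration
  conditioned on the others.\<close>

lemma glauber_eq:
  assumes V: "finite V" "V \<noteq> {}" and p: "set_pmf p \<subseteq> configs V" and \<sigma>: "\<sigma> \<in> set_pmf p"
  shows "glauber V p \<sigma> = pmf_of_set V \<bind> (\<lambda>v. cond_pmf p {\<tau>. restrict \<tau> (V - {v}) = restrict \<sigma> (V - {v})})"
  unfolding glauber_def
proof (rule bind_pmf_cong[OF refl])
  fix v assume "v \<in> set_pmf (pmf_of_set V)"
  then have v: "v \<in> V" using V by simp
  define q where "q = cond_pmf p {\<tau>. restrict \<tau> (V - {v}) = restrict \<sigma> (V - {v})}"
  have q: "set_pmf q = set_pmf p \<inter> {\<tau>. restrict \<tau> (V - {v}) = restrict \<sigma> (V - {v})}"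
    unfolding q_def using \<sigma> by (intro set_cond_pmf) auto
  have "marginal_at (pinned p (V - {v}) (restrict \<sigma> (V - {v}))) v \<bind> (\<lambda>c. return_pmf (\<sigma>(v := c)))
      = map_pmf (\<lambda>\<tau>. \<sigma>(v := \<tau> v)) q"
    by (simp add: marginal_at_def pinned_def q_def map_pmf_def bind_assoc_pmf bind_return_pmf)
  also have "\<dots> = map_pmf (\<lambda>\<tau>. \<tau>) q"
  proof (rule map_pmf_cong[OF refl])
    fix \<tau> assume "\<tau> \<in> set_pmf q"
    then have "\<tau> \<in> configs V" "restrict \<tau> (V - {v}) = restrict \<sigma> (V - {v})" using p q by auto
    moreover have "\<sigma> \<in> configs V" using p \<sigma> by auto
    ultimately show "\<sigma>(v := \<tau> v) = \<tau>"
      unfolding configs_def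
      by (intro ext) (metis (full_types) Diff_iff PiE_arb fun_upd_apply insertE empty_iff restrict_apply')
  qed
  finally show "marginal_at (pinned p (V - {v}) (restrict \<sigma> (V - {v}))) v \<bind> (\<lambda>c. return_pmf (\<sigma>(v := c)))
      = cond_pmf p {\<tau>. restrict \<tau> (V - {v}) = restrict \<sigma> (V - {v})}"
    by (simp add: q_def)
qed

lemma pmf_glauber:
  assumes V: "finite V" "V \<noteq> {}" and p: "set_pmf p \<subseteq> configs V" and \<sigma>: "\<sigma> \<in> set_pmf p"
  shows "pmf (glauber V p \<sigma>) \<tau> =
    (\<Sum>v\<in>V. pmf (cond_pmf p {\<tau>. restrict \<tau> (V - {v}) = restrict \<sigma> (V - {v})}) \<tau>) / card V"
  unfolding glauber_eq[OF assms] using V by (simp add: pmf_bind_pmf_of_set)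

text \<open>The transition kernel is the average over \<open>v\<close> of the projections onto
  functions of the spins off \<open>v\<close>; each projection contributes its residual norm by
  \<open>sum_cond_mean_residual\<close>.\<close>

lemma dirichlet_eq:
  assumes V: "finite V" "V \<noteq> {}" and p: "set_pmf p \<subseteq> configs V"
  shows "dirichlet V p f = mean p (\<lambda>\<sigma>. (f \<sigma>)\<^sup>2)
    - (\<Sum>\<sigma>\<in>set_pmf p. pmf p \<sigma> * f \<sigma> * (\<Sum>\<tau>\<in>set_pmf p. pmf (glauber V p \<sigma>) \<tau> * f \<tau>))"
proof -
  have fin: "finite (set_pmf p)" using finite_subset[OF p finite_configs[OF V(1)]] .
  let ?h = "\<lambda>v. cond_mean p (\<lambda>\<sigma>. restrict \<sigma> (V - {v})) f"
  have "(\<Sum>\<tau>\<in>set_pmf p. pmf (glauber V p \<sigma>) \<tau> * f \<tau>) = (\<Sum>v\<in>V. ?h v \<sigma>) / card V"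
    if "\<sigma> \<in> set_pmf p" for \<sigma>
  proof -
    have "(\<Sum>\<tau>\<in>set_pmf p. pmf (glauber V p \<sigma>) \<tau> * f \<tau>)
      = (\<Sum>\<tau>\<in>set_pmf p. \<Sum>v\<in>V. pmf (cond_pmf p {\<tau>. restrict \<tau> (V - {v}) = restrict \<sigma> (V - {v})}) \<tau> * f \<tau> / card V)"
      by (simp add: pmf_glauber[OF V p that] sum_distrib_right sum_divide_distrib)
    also have "\<dots> = (\<Sum>v\<in>V. \<Sum>\<tau>\<in>set_pmf p. pmf (cond_pmf p {\<tau>. restrict \<tau> (V - {v}) = restrict \<sigma> (V - {v})}) \<tau> * f \<tau> / card V)"
      by (rule sum.swap)
    finally show ?thesis by (simp add: cond_mean_def sum_divide_distrib)
  qed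
  then have "(\<Sum>\<sigma>\<in>set_pmf p. pmf p \<sigma> * f \<sigma> * (\<Sum>\<tau>\<in>set_pmf p. pmf (glauber V p \<sigma>) \<tau> * f \<tau>))
    = (\<Sum>\<sigma>\<in>set_pmf p. \<Sum>v\<in>V. pmf p \<sigma> * f \<sigma> * ?h v \<sigma> / card V)"
    by (intro sum.cong) (auto simp: sum_distrib_left sum_divide_distrib)
  also have "\<dots> = (\<Sum>v\<in>V. \<Sum>\<sigma>\<in>set_pmf p. pmf p \<sigma> * f \<sigma> * ?h v \<sigma> / card V)"
    by (rule sum.swap)
  finally have "(\<Sum>\<sigma>\<in>set_pmf p. pmf p \<sigma> * f \<sigma> * (\<Sum>\<tau>\<in>set_pmf p. pmf (glauber V p \<sigma>) \<tau> * f \<tau>))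
    = (\<Sum>v\<in>V. \<Sum>\<sigma>\<in>set_pmf p. pmf p \<sigma> * f \<sigma> * ?h v \<sigma>) / card V"
    by (simp add: sum_divide_distrib)
  then show ?thesis
    using V unfolding dirichlet_def mean_def sum_cond_mean_residual[OF fin] sum_subtractf
    by (simp add: diff_divide_distrib)
qed

section \<open>The spectral gap as the best Poincare constant\<close>

context
  fixes V :: "'v set" and p :: "'v config pmf"
  assumes V: "finite V" and p: "set_pmf p \<subseteq> configs V"
begin

lemma finite_set_pmf_configs: "finite (set_pmf p)"
  using finite_subset[OF p finite_configs[OF V]] .

lemma second_eigenvalue_glauber:
  assumes "card (set_pmf p) \<noteq> 1"
  defines "e \<equiv> second_eigenvalue_on (set_pmf p) (\<lambda>\<sigma> \<sigma>'. pmf (glauber V p \<sigma>) \<sigma>')"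
  shows "e \<le> 1"
    and "mean p f = 0 \<Longrightarrow> (1 - e) * mean p (\<lambda>x. (f x)\<^sup>2) \<le> dirichlet V p f"
    and "\<exists>f. mean p f = 0 \<and> mean p (\<lambda>x. (f x)\<^sup>2) > 0 \<and>
           dirichlet V p f \<le> (1 - e) * mean p (\<lambda>x. (f x)\<^sup>2)"
proof -
  note fin = finite_set_pmf_configs
  have "card (set_pmf p) \<noteq> 0" using fin set_pmf_not_empty by auto
  then have card: "card (set_pmf p) \<ge> 2" using assms(1) by linarith
  \<comment> \<open>With no sites there is only one configuration, against the two or more states
    present here.\<close>
  have ne: "V \<noteq> {}"
  proof
    assume "V = {}"
    then have "set_pmf p \<subseteq> {\<lambda>_. undefined}" using p by (auto simp: configs_def)
    then have "card (set_pmf p) \<le> card {\<lambda>_ :: 'v. undefined :: int}" by (intro card_mono) auto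
    then show False using card by simp
  qed
  let ?P = "\<lambda>\<sigma> \<sigma>'. pmf (glauber V p \<sigma>) \<sigma>'"
  have rev: "pmf p x * ?P x y = pmf p y * ?P y x" if "x \<in> set_pmf p" "y \<in> set_pmf p" for x y
    unfolding pmf_glauber[OF V ne p that(1)] pmf_glauber[OF V ne p that(2)] times_divide_eq_right sum_distrib_left
    by (intro arg_cong2[of _ _ _ _ "(/)"] sum.cong refl cond_fibre_reversible[OF fin] that)
  have one: "(\<Sum>y\<in>set_pmf p. ?P x y) = 1" if x: "x \<in> set_pmf p" for x
  proof (rule sum_pmf_eq_1[OF fin])
    have "set_pmf (cond_pmf p {\<tau>. restrict \<tau> (V - {v}) = restrict x (V - {v})}) \<subseteq> set_pmf p" for v
      using x by (subst set_cond_pmf) auto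
    then show "set_pmf (glauber V p x) \<subseteq> set_pmf p"
      unfolding glauber_eq[OF V ne p x] by auto
  qed
  have form: "(\<Sum>x\<in>set_pmf p. pmf p x * f x * (\<Sum>y\<in>set_pmf p. ?P x y * f y))
      = mean p (\<lambda>x. (f x)\<^sup>2) - dirichlet V p f" for f
    using dirichlet_eq[OF V ne p, of f] by simp
  \<comment> \<open>The contraction property of the kernel is nonnegativity of the Dirichlet
    form.\<close>
  have contr: "(\<Sum>x\<in>set_pmf p. pmf p x * f x * (\<Sum>y\<in>set_pmf p. ?P x y * f y)) \<le> (\<Sum>x\<in>set_pmf p. pmf p x * (f x)\<^sup>2)" for f
    unfolding form using dirichlet_nonneg[of V p f] by (simp add: mean_def)
  note main = reversible_second_eigenvalue[where p = "pmf p" and P = ?P, OF fin card pmf_positive rev one contr,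
      unfolded form, folded e_def mean_def]
  show "e \<le> 1" by (rule main(1))
  show "(1 - e) * mean p (\<lambda>x. (f x)\<^sup>2) \<le> dirichlet V p f" if "mean p f = 0"
  proof -
    have "mean p (\<lambda>x. (f x)\<^sup>2) - dirichlet V p f \<le> e * mean p (\<lambda>x. (f x)\<^sup>2)"
      by (rule main(2)) (use that in auto)
    then show ?thesis by (simp add: algebra_simps)
  qed
  show "\<exists>f. mean p f = 0 \<and> mean p (\<lambda>x. (f x)\<^sup>2) > 0 \<and>
           dirichlet V p f \<le> (1 - e) * mean p (\<lambda>x. (f x)\<^sup>2)"
  proof -
    have "\<exists>f. mean p f = 0 \<and> 0 < mean p (\<lambda>x. (f x)\<^sup>2) \<and>
        e * mean p (\<lambda>x. (f x)\<^sup>2) \<le> mean p (\<lambda>x. (f x)\<^sup>2) - dirichlet V p f"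
      by (rule main(3)) auto
    then show ?thesis by (auto simp: algebra_simps)
  qed
qed

lemma gap_GD_nonneg: "gap_GD V p \<ge> 0"
  using second_eigenvalue_glauber(1) by (simp add: gap_GD_def)

lemma gap_GD_poincare: "gap_GD V p * var p f \<le> dirichlet V p f"
proof (cases "card (set_pmf p) = 1")
  case True
  then obtain x where x: "set_pmf p = {x}" by (auto simp: card_1_singleton_iff)
  then have "pmf p x = 1" using sum_set_pmf[OF finite_set_pmf_configs] by simp
  then have "var p f = 0" by (simp add: var_def mean_def x)
  then show ?thesis by (simp add: dirichlet_nonneg)
next
  case False
  have "mean p (\<lambda>x. f x - mean p f) = 0"
    by (simp add: mean_diff_const[OF finite_set_pmf_configs])
  from second_eigenvalue_glauber(2)[OF False this] False show ?thesis
    by (simp add: gap_GD_def var_def dirichlet_diff_const[OF finite_set_pmf_configs])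
qed

text \<open>The inequality is tested on the extremal function of the second eigenvalue. The bound
  \<open>c \<le> 1\<close> serves the one-state case, where the gap is 1 by convention.\<close>

lemma gap_GD_geI:
  assumes "c \<le> 1" "\<And>f. c * var p f \<le> dirichlet V p f"
  shows "c \<le> gap_GD V p"
proof (cases "card (set_pmf p) = 1")
  case True
  then show ?thesis using assms by (simp add: gap_GD_def)
next
  case False
  obtain f where f: "mean p f = 0" "mean p (\<lambda>x. (f x)\<^sup>2) > 0"
    "dirichlet V p f \<le> gap_GD V p * mean p (\<lambda>x. (f x)\<^sup>2)"
    using second_eigenvalue_glauber(3)[OF False] False by (auto simp: gap_GD_def)
  have "c * mean p (\<lambda>x. (f x)\<^sup>2) \<le> gap_GD V p * mean p (\<lambda>x. (f x)\<^sup>2)"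
    using order_trans[OF assms(2)[of f] f(3)] f(1) by (simp only: var_def diff_zero)
  then show ?thesis using f(2) by simp
qed

end

text \<open>For each component its own conditional mean is the best approximation of
  \<open>f\<close> by a function of the other spins, so using that of \<open>p\<close> instead can
  only increase the residual. After this replacement the expression is linear in the
  distribution.\<close>

lemma dirichlet_mixture:
  assumes fin: "finite (set_pmf p)" and I: "finite I"
    and c: "\<And>i. i \<in> I \<Longrightarrow> c i \<ge> 0"
    and q: "\<And>i. i \<in> I \<Longrightarrow> c i \<noteq> 0 \<Longrightarrow> set_pmf (q i) \<subseteq> set_pmf p"
    and mix: "\<And>x. x \<in> set_pmf p \<Longrightarrow> (\<Sum>i\<in>I. c i * pmf (q i) x) = pmf p x"
  shows "(\<Sum>i\<in>I. c i * dirichlet V (q i) f) \<le> dirichlet V p f"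
proof -
  have mean_mix: "(\<Sum>i\<in>I. c i * mean (q i) g) = mean p g" for g
  proof -
    have "c i * mean (q i) g = (\<Sum>x\<in>set_pmf p. c i * pmf (q i) x * g x)" if "i \<in> I" for i
    proof (cases "c i = 0")
      case False
      then have "mean (q i) g = (\<Sum>x\<in>set_pmf p. pmf (q i) x * g x)"
        unfolding mean_def using fin q[OF that] by (intro sum.mono_neutral_left) (auto simp: set_pmf_iff)
      then show ?thesis by (simp add: sum_distrib_left mult.assoc)
    qed simp
    then have "(\<Sum>i\<in>I. c i * mean (q i) g) = (\<Sum>i\<in>I. \<Sum>x\<in>set_pmf p. c i * pmf (q i) x * g x)"
      by (intro sum.cong) auto
    also have "\<dots> = (\<Sum>x\<in>set_pmf p. \<Sum>i\<in>I. c i * pmf (q i) x * g x)" by (rule sum.swap)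
    also have "\<dots> = mean p g"
      by (simp add: mean_def sum_distrib_right[symmetric] mix)
    finally show ?thesis .
  qed
  let ?k = "\<lambda>v \<sigma>. restrict \<sigma> (V - {v})"
  have le: "c i * mean (q i) (\<lambda>\<sigma>. (f \<sigma> - cond_mean (q i) (?k v) f \<sigma>)\<^sup>2)
      \<le> c i * mean (q i) (\<lambda>\<sigma>. (f \<sigma> - cond_mean p (?k v) f \<sigma>)\<^sup>2)" if i: "i \<in> I" for i v
  proof (cases "c i = 0")
    case False
    have "finite (set_pmf (q i))" using q[OF i False] fin finite_subset by blast
    then have "mean (q i) (\<lambda>\<sigma>. (f \<sigma> - cond_mean (q i) (?k v) f \<sigma>)\<^sup>2)
        \<le> mean (q i) (\<lambda>\<sigma>. (f \<sigma> - cond_mean p (?k v) f \<sigma>)\<^sup>2)"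
      unfolding mean_def by (rule cond_mean_minimises) (rule cond_mean_fibre[OF fin])
    then show ?thesis using c[OF i] by (rule mult_left_mono)
  qed simp
  have "(\<Sum>i\<in>I. c i * dirichlet V (q i) f)
    = (\<Sum>i\<in>I. \<Sum>v\<in>V. c i * mean (q i) (\<lambda>\<sigma>. (f \<sigma> - cond_mean (q i) (?k v) f \<sigma>)\<^sup>2)) / card V"
    unfolding dirichlet_def by (simp add: sum_distrib_left sum_divide_distrib)
  also have "\<dots> \<le> (\<Sum>i\<in>I. \<Sum>v\<in>V. c i * mean (q i) (\<lambda>\<sigma>. (f \<sigma> - cond_mean p (?k v) f \<sigma>)\<^sup>2)) / card V"
    by (intro divide_right_mono sum_mono le) auto
  also have "(\<Sum>i\<in>I. \<Sum>v\<in>V. c i * mean (q i) (\<lambda>\<sigma>. (f \<sigma> - cond_mean p (?k v) f \<sigma>)\<^sup>2))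
     = (\<Sum>v\<in>V. \<Sum>i\<in>I. c i * mean (q i) (\<lambda>\<sigma>. (f \<sigma> - cond_mean p (?k v) f \<sigma>)\<^sup>2))" by (rule sum.swap)
  also have "\<dots> / card V = dirichlet V p f"
    by (simp add: dirichlet_def mean_mix)
  finally show ?thesis .
qed

section \<open>Quadratic forms and the spectral radius\<close>

lemma spectral_radius_nonneg:
  assumes "A \<in> carrier_mat n n" "n > 0"
  shows "spectral_radius A \<ge> 0"
  using spectral_radius_mem_max(1)[OF assms] by auto

text \<open>An eigenvalue \<open>e\<close> of the scaled matrix gives the eigenvalue
  \<open>r * e\<close> of \<open>M\<close>, so scaling by \<open>1 / r\<close> brings the spectral
  radius below 1, where powers stay bounded.\<close>

lemma pow_mat_bounded_of_spectral_radius_less: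
  assumes M: "M \<in> carrier_mat n n" and n: "n > 0" and r: "spectral_radius M < r"
  shows "\<exists>c. \<forall>k. norm_bound (((1 / complex_of_real r) \<cdot>\<^sub>m M) ^\<^sub>m k) c"
proof (rule spectral_radius_jnf_norm_bound_less_1_upper_triangular)
  let ?N = "(1 / complex_of_real r) \<cdot>\<^sub>m M"
  show N: "?N \<in> carrier_mat n n" using M by simp
  have r0: "r > 0" using spectral_radius_nonneg[OF M n] r by simp
  obtain e where e: "e \<in> spectrum ?N" "spectral_radius ?N = norm e"
    using spectral_radius_mem_max(1)[OF N n] by auto
  then obtain v where v: "v \<in> carrier_vec n" "v \<noteq> 0\<^sub>v n" "?N *\<^sub>v v = e \<cdot>\<^sub>v v"
    using M by (auto simp: spectrum_def eigenvalue_def eigenvector_def)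
  have "complex_of_real r \<cdot>\<^sub>v (?N *\<^sub>v v) = (of_real r * e) \<cdot>\<^sub>v v"
    by (simp add: v smult_smult_assoc)
  moreover have "complex_of_real r \<cdot>\<^sub>v (?N *\<^sub>v v) = M *\<^sub>v v"
    by (rule eq_vecI) (use M v(1) r0 in auto)
  ultimately have "of_real r * e \<in> spectrum M"
    using v M by (auto simp: spectrum_def eigenvalue_def eigenvector_def)
  then have "norm (of_real r * e) \<le> spectral_radius M"
    by (intro spectral_radius_mem_max(2)[OF M n]) auto
  then have "r * norm e \<le> spectral_radius M" using r0 by (simp add: norm_mult)
  then have "r * norm e < r * 1" using r by linarith
  then show "spectral_radius ?N < 1" unfolding mult_less_cancel_left_pos[OF r0] e(2) .
qed

text \<open>A substitute for the Perron vector that works without irreducibility. \<open>h\<close>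
  is the truncated Neumann series of \<open>A / r\<close> applied to the constant 1: its zeroth term
  makes it positive, and applying \<open>A / r\<close> shifts it, losing the 1 and gaining a
  remainder that is at most 1 for a late truncation.\<close>

lemma subinvariant_vector_exists:
  fixes A :: "'a \<Rightarrow> 'a \<Rightarrow> real"
  assumes W: "finite W" "W \<noteq> {}"
    and nonneg: "\<And>u v. u \<in> W \<Longrightarrow> v \<in> W \<Longrightarrow> A u v \<ge> 0"
    and r: "spectral_radius_on W A < r"
  obtains h where "\<And>u. u \<in> W \<Longrightarrow> h u > 0" "\<And>u. u \<in> W \<Longrightarrow> (\<Sum>v\<in>W. A u v * h v) \<le> r * h u"
proof -
  define n where "n = card W"
  have n: "n > 0" using W by (auto simp: n_def card_gt_0_iff)
  define x where "x = (!) (enum_of W)"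
  have xW: "x i \<in> W" if "i < n" for i
    using that nth_mem[of i "enum_of W"] unfolding x_def n_def enum_of(2,3)[OF W(1)] by simp
  have sumW: "sum g W = (\<Sum>i<n. g (x i))" for g :: "'a \<Rightarrow> real"
    unfolding n_def x_def by (rule sum_enum_of[OF W(1)])
  define M where "M = mat_on W (\<lambda>u v. complex_of_real (A u v))"
  have M: "M \<in> carrier_mat n n" by (simp add: M_def mat_on_def n_def)
  have \<rho>: "spectral_radius_on W A = spectral_radius M"
    using W by (simp add: spectral_radius_on_def M_def)
  \<comment> \<open>The intermediate rate \<open>t\<close> leaves room: iterates of \<open>A\<close>
    grow at most like \<open>t ^ k\<close>, so relative to \<open>r ^ k\<close> they decay.\<close>
  obtain t where t: "spectral_radius M < t" "t < r" using r \<rho> dense by auto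
  have t0: "t > 0" using spectral_radius_nonneg[OF M n] t by simp
  then have r0: "r > 0" using t by simp
  define N where "N = (1 / complex_of_real t) \<cdot>\<^sub>m M"
  have N: "N \<in> carrier_mat n n" using M by (simp add: N_def)
  obtain c where c: "\<And>k. norm_bound (N ^\<^sub>m k) c"
    using pow_mat_bounded_of_spectral_radius_less[OF M n t(1)] unfolding N_def by blast
  \<comment> \<open>\<open>F k\<close> is the \<open>k\<close>-th power of \<open>A\<close> applied
    to the constant 1.\<close>
  define F where "F = rec_nat (\<lambda>u. 1) (\<lambda>k f u. \<Sum>v\<in>W. A u v * f v)"
  have F0: "F 0 u = 1" and FS: "F (Suc k) u = (\<Sum>v\<in>W. A u v * F k v)" for k u
    by (auto simp: F_def)
  have Fnn: "F k u \<ge> 0" if "u \<in> W" for k u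
    using that by (induction k arbitrary: u) (auto simp: F0 FS intro!: sum_nonneg nonneg mult_nonneg_nonneg)
  define w where "w k = N ^\<^sub>m k *\<^sub>v vec n (\<lambda>_. 1)" for k
  have Nk: "N ^\<^sub>m k \<in> carrier_mat n n" for k using N by (rule pow_carrier_mat)
  \<comment> \<open>Matrix powers multiply the new factor on the right, whereas \<open>F\<close>
    applies the new factor on the left.\<close>
  have comm: "N ^\<^sub>m k * N = N * N ^\<^sub>m k" for k
  proof (induction k)
    case (Suc k)
    then show ?case using N Nk by (simp add: assoc_mult_mat[of _ n n _ n _ n])
  qed (use N in auto)
  have w: "vec_index (w k) i = complex_of_real (F k (x i) / t ^ k)" if "i < n" for k i
    using that
  proof (induction k arbitrary: i)
    case 0
    then show ?case using N by (simp add: w_def F0)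
  next
    case (Suc k)
    have "w (Suc k) = N *\<^sub>v w k"
      using N Nk by (simp add: w_def comm assoc_mult_mat_vec[of _ n n _ n])
    moreover have "vec_index (N *\<^sub>v y) i = (\<Sum>j<n. N $$ (i, j) * vec_index y j)" if "dim_vec y = n" for y
      using Suc.prems N that by (simp add: scalar_prod_def atLeast0LessThan)
    moreover have "dim_vec (w k) = n" using N by (simp add: w_def)
    ultimately have "vec_index (w (Suc k)) i = (\<Sum>j<n. N $$ (i, j) * vec_index (w k) j)"
      by simp
    also have "\<dots> = (\<Sum>j<n. of_real (A (x i) (x j) / t * (F k (x j) / t ^ k)))"
      using Suc M by (intro sum.cong) (auto simp: N_def M_def mat_on_def x_def n_def)
    also have "\<dots> = of_real (\<Sum>j<n. A (x i) (x j) / t * (F k (x j) / t ^ k))"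
      by simp
    also have "(\<Sum>j<n. A (x i) (x j) / t * (F k (x j) / t ^ k)) = F (Suc k) (x i) / t ^ Suc k"
      by (simp add: FS sumW sum_divide_distrib algebra_simps)
    finally show ?case .
  qed
  have bound: "F k (x i) \<le> n * c * t ^ k" if i: "i < n" for k i
  proof -
    have "norm (vec_index (w k) i) = norm (\<Sum>j<n. (N ^\<^sub>m k) $$ (i, j))"
      using i N Nk[of k] by (simp add: w_def scalar_prod_def atLeast0LessThan)
    also have "\<dots> \<le> (\<Sum>j<n. c)"
      using c[of k] i N Nk[of k] by (intro sum_norm_le) (auto simp: norm_bound_def)
    finally have "F k (x i) / t ^ k \<le> n * c"
      using w[OF i] t0 Fnn[OF xW[OF i]] by (simp add: norm_divide norm_power)
    then show ?thesis using t0 by (simp add: pos_divide_le_eq)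
  qed
  \<comment> \<open>Chosen so that \<open>n * c * t ^ Suc K\<close> is at most
    \<open>r ^ Suc K\<close>; the added 1 keeps the denominator positive.\<close>
  obtain K where K: "(t / r) ^ K < 1 / (n * \<bar>c\<bar> + 1)"
    using real_arch_pow_inv[of "1 / (n * \<bar>c\<bar> + 1)" "t / r"] t r0 by (auto simp: add_nonneg_pos)
  have last: "F (Suc K) u \<le> r ^ Suc K" if u: "u \<in> W" for u
  proof -
    obtain i where i: "i < n" "u = x i"
      using u enum_of(2,3)[OF W(1)] by (metis in_set_conv_nth n_def x_def)
    have d: "n * \<bar>c\<bar> + 1 > 0" by (simp add: add_nonneg_pos)
    have "(t / r) ^ Suc K \<le> (t / r) ^ K" using t t0 r0 by (intro power_decreasing) auto
    then have "(t / r) ^ Suc K < 1 / (n * \<bar>c\<bar> + 1)" using K by simp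
    then have "(n * \<bar>c\<bar> + 1) * t ^ Suc K \<le> r ^ Suc K"
      using d r0 by (simp add: power_divide field_simps del: power_Suc)
    moreover have "n * c * t ^ Suc K \<le> (n * \<bar>c\<bar> + 1) * t ^ Suc K"
      using t0 by (intro mult_right_mono) (auto simp: mult_left_mono add_increasing2)
    ultimately show ?thesis using bound[OF i(1), of "Suc K"] unfolding i(2) by (metis order_trans)
  qed
  define h where "h u = (\<Sum>k\<le>K. F k u / r ^ k)" for u
  have hs: "h u = 1 + (\<Sum>k<K. F (Suc k) u / r ^ Suc k)" for u
    unfolding h_def by (subst sum.atMost_shift) (simp add: F0)
  show thesis
  proof
    fix u assume u: "u \<in> W"
    have "(\<Sum>k<K. F (Suc k) u / r ^ Suc k) \<ge> 0"
      using Fnn[OF u] r0 by (intro sum_nonneg divide_nonneg_nonneg) auto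
    then show "h u > 0" unfolding hs by simp
    have "(\<Sum>v\<in>W. A u v * h v) = (\<Sum>v\<in>W. \<Sum>k\<le>K. A u v * F k v / r ^ k)"
      by (simp add: h_def sum_distrib_left)
    also have "\<dots> = (\<Sum>k\<le>K. \<Sum>v\<in>W. A u v * F k v / r ^ k)" by (rule sum.swap)
    also have "\<dots> = (\<Sum>k\<le>K. F (Suc k) u / r ^ k)" by (simp add: FS sum_divide_distrib)
    also have "\<dots> = r * (\<Sum>k\<le>K. F (Suc k) u / r ^ Suc k)"
      using r0 by (simp add: sum_distrib_left)
    also have "(\<Sum>k\<le>K. F (Suc k) u / r ^ Suc k) = h u - 1 + F (Suc K) u / r ^ Suc K"
      unfolding hs lessThan_Suc_atMost[symmetric] sum.lessThan_Suc by simp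
    also have "\<dots> \<le> h u"
      using last[OF u] r0 by (simp add: divide_le_eq del: power_Suc)
    finally show "(\<Sum>v\<in>W. A u v * h v) \<le> r * h u" using r0 by simp
  qed
qed

text \<open>Schur's test, with a positive vector that is subinvariant under \<open>A\<close> as test weight.\<close>

lemma quadratic_form_le_of_spectral_radius:
  fixes A C :: "'a \<Rightarrow> 'a \<Rightarrow> real"
  assumes W: "finite W"
    and nonneg: "\<And>u v. u \<in> W \<Longrightarrow> v \<in> W \<Longrightarrow> A u v \<ge> 0"
    and \<eta>: "spectral_radius_on W A \<le> \<eta>"
    and p: "\<And>u. u \<in> W \<Longrightarrow> p u \<ge> 0"
    and sym: "\<And>u v. u \<in> W \<Longrightarrow> v \<in> W \<Longrightarrow> C u v = C v u"
    and C: "\<And>u v. u \<in> W \<Longrightarrow> v \<in> W \<Longrightarrow> \<bar>C u v\<bar> \<le> p u * ((if u = v then 1 else 0) + A u v)"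
  shows "(\<Sum>u\<in>W. \<Sum>v\<in>W. C u v * x u * x v) \<le> (1 + \<eta>) * (\<Sum>u\<in>W. p u * (x u)\<^sup>2)"
proof (cases "W = {}")
  case False
  let ?Y = "\<Sum>u\<in>W. p u * (x u)\<^sup>2"
  have Y: "?Y \<ge> 0" using p by (intro sum_nonneg) auto
  \<comment> \<open>A subinvariant vector is available only for rates strictly above the spectral
    radius, so the bound is first shown for every \<open>r > \<eta>\<close> and then passed to the
    limit.\<close>
  have main: "(\<Sum>u\<in>W. \<Sum>v\<in>W. C u v * x u * x v) \<le> (1 + r) * ?Y" if r: "r > \<eta>" for r
  proof -
    have "spectral_radius_on W A < r" using \<eta> r by simp
    from subinvariant_vector_exists[OF W False nonneg this] obtain h
      where h: "\<And>u. u \<in> W \<Longrightarrow> h u > 0" and Ah: "\<And>u. u \<in> W \<Longrightarrow> (\<Sum>v\<in>W. A u v * h v) \<le> r * h u"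
      by blast
    \<comment> \<open>Weighted AM-GM with weights \<open>h v / h u\<close> splits each entry into a
      row part and a column part; by symmetry of \<open>C\<close> both have the same total, and
      subinvariance bounds the row sums.\<close>
    let ?T = "\<lambda>u v. \<bar>C u v\<bar> * (x u)\<^sup>2 * h v / h u"
    have "(\<Sum>u\<in>W. \<Sum>v\<in>W. C u v * x u * x v) \<le> (\<Sum>u\<in>W. \<Sum>v\<in>W. (?T u v + ?T v u) / 2)"
    proof (intro sum_mono)
      fix u v assume uv: "u \<in> W" "v \<in> W"
      note hu = h[OF uv(1)] and hv = h[OF uv(2)]
      have "0 \<le> (\<bar>x u\<bar> * h v - \<bar>x v\<bar> * h u)\<^sup>2" by simp
      then have "2 * (\<bar>x u\<bar> * \<bar>x v\<bar>) * (h u * h v) \<le> (x u)\<^sup>2 * (h v)\<^sup>2 + (x v)\<^sup>2 * (h u)\<^sup>2"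
        by (simp add: power2_diff power_mult_distrib algebra_simps)
      then have "\<bar>x u\<bar> * \<bar>x v\<bar> \<le> ((x u)\<^sup>2 * h v / h u + (x v)\<^sup>2 * h u / h v) / 2"
        using hu hv by (simp add: field_simps power2_eq_square)
      then have "\<bar>C u v\<bar> * (\<bar>x u\<bar> * \<bar>x v\<bar>) \<le> \<bar>C u v\<bar> * (((x u)\<^sup>2 * h v / h u + (x v)\<^sup>2 * h u / h v) / 2)"
        by (intro mult_left_mono) auto
      moreover have "C u v * x u * x v \<le> \<bar>C u v\<bar> * (\<bar>x u\<bar> * \<bar>x v\<bar>)"
        by (metis abs_ge_self abs_mult mult.assoc)
      ultimately show "C u v * x u * x v \<le> (?T u v + ?T v u) / 2"
        using sym[OF uv] by (simp add: algebra_simps)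
    qed
    also have "\<dots> = ((\<Sum>u\<in>W. \<Sum>v\<in>W. ?T u v) + (\<Sum>u\<in>W. \<Sum>v\<in>W. ?T v u)) / 2"
      by (simp add: sum.distrib sum_divide_distrib add_divide_distrib)
    also have "(\<Sum>u\<in>W. \<Sum>v\<in>W. ?T v u) = (\<Sum>u\<in>W. \<Sum>v\<in>W. ?T u v)" by (rule sum.swap)
    also have "((\<Sum>u\<in>W. \<Sum>v\<in>W. ?T u v) + (\<Sum>u\<in>W. \<Sum>v\<in>W. ?T u v)) / 2 = (\<Sum>u\<in>W. \<Sum>v\<in>W. ?T u v)" by simp
    also have "\<dots> \<le> (\<Sum>u\<in>W. (1 + r) * (p u * (x u)\<^sup>2))"
    proof (rule sum_mono)
      fix u assume u: "u \<in> W"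
      have "(\<Sum>v\<in>W. ?T u v) = (x u)\<^sup>2 / h u * (\<Sum>v\<in>W. \<bar>C u v\<bar> * h v)"
        by (simp add: sum_distrib_left algebra_simps)
      also have "\<dots> \<le> (x u)\<^sup>2 / h u * (\<Sum>v\<in>W. (p u * ((if u = v then 1 else 0) + A u v)) * h v)"
        using h u C by (intro mult_left_mono sum_mono mult_right_mono) (auto simp: less_imp_le)
      also have "(\<Sum>v\<in>W. (p u * ((if u = v then 1 else 0) + A u v)) * h v)
          = (\<Sum>v\<in>W. (if u = v then p u * h u else 0) + p u * (A u v * h v))"
        by (intro sum.cong) (auto simp: algebra_simps)
      also have "\<dots> = p u * (h u + (\<Sum>v\<in>W. A u v * h v))"
        using W u by (simp add: sum.distrib sum_distrib_left algebra_simps)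
      also have "(x u)\<^sup>2 / h u * (p u * (h u + (\<Sum>v\<in>W. A u v * h v))) \<le> (x u)\<^sup>2 / h u * (p u * (h u + r * h u))"
        using Ah[OF u] h[OF u] p[OF u] by (intro mult_left_mono add_left_mono) auto
      also have "\<dots> = (1 + r) * (p u * (x u)\<^sup>2)"
        using h[OF u] by (simp add: field_simps)
      finally show "(\<Sum>v\<in>W. ?T u v) \<le> (1 + r) * (p u * (x u)\<^sup>2)" .
    qed
    also have "\<dots> = (1 + r) * ?Y" by (simp add: sum_distrib_left)
    finally show ?thesis .
  qed
  show ?thesis
  proof (rule field_le_epsilon)
    fix e :: real assume e: "e > 0"
    \<comment> \<open>The excess of \<open>r\<close> over \<open>\<eta>\<close> is scaled so that,
      multiplied by \<open>?Y\<close>, it stays below \<open>e\<close>, also when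
      \<open>?Y = 0\<close>.\<close>
    have "e / (?Y + 1) > 0" using e Y by simp
    then have "(\<Sum>u\<in>W. \<Sum>v\<in>W. C u v * x u * x v) \<le> (1 + (\<eta> + e / (?Y + 1))) * ?Y"
      by (intro main) simp
    also have "\<dots> = (1 + \<eta>) * ?Y + e * (?Y / (?Y + 1))" by (simp add: algebra_simps)
    also have "e * (?Y / (?Y + 1)) \<le> e * 1" using e Y by (intro mult_left_mono) auto
    finally show "(\<Sum>u\<in>W. \<Sum>v\<in>W. C u v * x u * x v) \<le> (1 + \<eta>) * ?Y + e" by simp
  qed
qed simp

section \<open>Covariances and influences\<close>

definition plus_at :: "'v \<Rightarrow> 'v config \<Rightarrow> real" where
  "plus_at v \<sigma> = (if \<sigma> v = 1 then 1 else 0)"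

definition cov :: "'a pmf \<Rightarrow> ('a \<Rightarrow> real) \<Rightarrow> ('a \<Rightarrow> real) \<Rightarrow> real" where
  "cov p f g = mean p (\<lambda>x. f x * g x) - mean p f * mean p g"

lemma cov_commute: "cov p f g = cov p g f"
  by (simp add: cov_def mult.commute)

lemma var_eq_cov: "finite (set_pmf p) \<Longrightarrow> var p f = cov p f f"
  by (simp add: var_eq cov_def power2_eq_square)

lemma mean_sum: "mean p (\<lambda>x. \<Sum>i\<in>I. h i x) = (\<Sum>i\<in>I. mean p (h i))"
  unfolding mean_def sum_distrib_left by (rule sum.swap)

lemma mean_mult_left: "mean p (\<lambda>x. c * f x) = c * mean p f"
  by (simp add: mean_def sum_distrib_left algebra_simps)

lemma mean_diff: "mean p (\<lambda>x. f x - g x) = mean p f - mean p g"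
  by (simp add: mean_def sum_subtractf algebra_simps)

lemma cov_sum: "cov p f (\<lambda>x. \<Sum>i\<in>I. c i * h i x) = (\<Sum>i\<in>I. c i * cov p f (h i))"
proof -
  have "mean p (\<lambda>x. f x * (\<Sum>i\<in>I. c i * h i x)) = mean p (\<lambda>x. \<Sum>i\<in>I. c i * (f x * h i x))"
    by (simp add: sum_distrib_left mult.left_commute)
  also have "\<dots> = (\<Sum>i\<in>I. c i * mean p (\<lambda>x. f x * h i x))"
    by (simp only: mean_sum mean_mult_left)
  finally show ?thesis
    unfolding cov_def
    by (simp add: mean_sum mean_mult_left right_diff_distrib sum_subtractf sum_distrib_left mult.left_commute)
qed

lemma cov_diff: "cov p f (\<lambda>x. g x - h x) = cov p f g - cov p f h"
  by (simp add: cov_def mean_diff algebra_simps)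

lemma cov_mult: "cov p f (\<lambda>x. c * g x) = c * cov p f g"
  by (simp add: cov_def mean_mult_left algebra_simps mult.left_commute[of _ c])

text \<open>The dual form of a bound on the covariance matrix: \<open>0 \<le> var (f - s g)\<close> for
  \<open>g = \<Sum>\<^sub>v x\<^sub>v h\<^sub>v\<close> with \<open>x\<^sub>v = cov f h\<^sub>v / w\<^sub>v\<close> and \<open>s = 1 / L\<close>.\<close>

lemma sum_cov_squares_le:
  assumes fin: "finite (set_pmf p)" and L: "L > 0"
    and w: "\<And>v. v \<in> W \<Longrightarrow> w v = 0 \<Longrightarrow> cov p f (h v) = 0"
    and quad: "\<And>x. (\<Sum>u\<in>W. \<Sum>v\<in>W. cov p (h u) (h v) * x u * x v) \<le> L * (\<Sum>u\<in>W. w u * (x u)\<^sup>2)"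
  shows "(\<Sum>v\<in>W. (cov p f (h v))\<^sup>2 / w v) \<le> L * var p f"
proof -
  \<comment> \<open>At a zero weight the quotient is 0, so such sites drop out of all the sums
    below.\<close>
  define x where "x v = cov p f (h v) / w v" for v
  define S where "S = (\<Sum>v\<in>W. (cov p f (h v))\<^sup>2 / w v)"
  define g where "g = (\<lambda>\<sigma>. \<Sum>v\<in>W. x v * h v \<sigma>)"
  have fg: "cov p f g = S"
    unfolding g_def cov_sum S_def by (intro sum.cong) (auto simp: x_def power2_eq_square)
  have "cov p g g = (\<Sum>u\<in>W. \<Sum>v\<in>W. cov p (h u) (h v) * x u * x v)"
  proof -
    have cg: "cov p k g = (\<Sum>v\<in>W. x v * cov p k (h v))" for k
      unfolding g_def by (rule cov_sum)
    have "cov p g g = (\<Sum>u\<in>W. x u * cov p (h u) g)"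
      unfolding cg[of g] by (simp add: cov_commute[of p g])
    also have "\<dots> = (\<Sum>u\<in>W. x u * (\<Sum>v\<in>W. x v * cov p (h u) (h v)))"
      by (simp only: cg)
    finally show ?thesis by (simp add: sum_distrib_left algebra_simps)
  qed
  also have "\<dots> \<le> L * (\<Sum>u\<in>W. w u * (x u)\<^sup>2)" by (rule quad)
  also have "(\<Sum>u\<in>W. w u * (x u)\<^sup>2) = S"
    unfolding S_def using w by (intro sum.cong) (auto simp: x_def power2_eq_square)
  finally have gg: "cov p g g \<le> L * S" .
  have "0 \<le> var p (\<lambda>\<sigma>. f \<sigma> - (1 / L) * g \<sigma>)" by (rule var_nonneg)
  also have "\<dots> = cov p f f - 2 / L * cov p f g + (1 / L)\<^sup>2 * cov p g g"
  proof -
    have "cov p (\<lambda>\<sigma>. f \<sigma> - (1 / L) * g \<sigma>) k = cov p k f - (1 / L) * cov p k g" for k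
      unfolding cov_commute[of p _ k] by (simp only: cov_diff cov_mult)
    then show ?thesis
      unfolding var_eq_cov[OF fin] cov_commute[of p f g]
      by (simp only: cov_diff cov_mult cov_commute[of p g f]) (simp add: algebra_simps power2_eq_square)
  qed
  also have "\<dots> \<le> cov p f f - 2 / L * S + (1 / L)\<^sup>2 * (L * S)"
    unfolding fg using gg by (intro add_left_mono mult_left_mono) auto
  also have "\<dots> = var p f - S / L"
    using L by (simp add: var_eq_cov[OF fin] field_simps power2_eq_square)
  finally show ?thesis using L by (simp add: S_def field_simps)
qed

section \<open>Total variation distance and the entrywise influence bound\<close>

lemma tv_dist_nonneg: "tv_dist p q \<ge> 0"
  by (simp add: tv_dist_def sum_nonneg)

text \<open>Both distributions have mass 1, so the difference at \<open>x\<close> is balanced by the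
  other points. The sum of absolute differences is hence at least twice the one at \<open>x\<close>,
  which cancels the half in \<open>tv_dist\<close>.\<close>

lemma abs_pmf_diff_le_tv_dist:
  assumes "finite (set_pmf p)" "finite (set_pmf q)"
  shows "\<bar>pmf p x - pmf q x\<bar> \<le> tv_dist p q"
proof (cases "x \<in> set_pmf p \<union> set_pmf q")
  case False
  then have "pmf p x = 0" "pmf q x = 0" by (auto simp: set_pmf_iff)
  then show ?thesis by (simp add: tv_dist_nonneg)
next
  case True
  let ?U = "set_pmf p \<union> set_pmf q"
  have fin: "finite ?U" using assms by simp
  have "(\<Sum>y\<in>?U. pmf p y - pmf q y) = 0"
    using sum_pmf_eq_1[OF fin, of p] sum_pmf_eq_1[OF fin, of q] by (simp add: sum_subtractf)
  then have "pmf p x - pmf q x = - (\<Sum>y\<in>?U - {x}. pmf p y - pmf q y)"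
    using sum.remove[OF fin True, of "\<lambda>y. pmf p y - pmf q y"] by linarith
  then have "\<bar>pmf p x - pmf q x\<bar> \<le> (\<Sum>y\<in>?U - {x}. \<bar>pmf p y - pmf q y\<bar>)"
    by (simp only: abs_minus_cancel sum_abs)
  moreover have "(\<Sum>y\<in>?U. \<bar>pmf p y - pmf q y\<bar>)
      = \<bar>pmf p x - pmf q x\<bar> + (\<Sum>y\<in>?U - {x}. \<bar>pmf p y - pmf q y\<bar>)"
    by (rule sum.remove[OF fin True])
  ultimately show ?thesis by (simp add: tv_dist_def)
qed

lemma influence_ge:
  assumes fin: "finite (set_pmf (pinned q R \<rho>))" and uv: "u \<noteq> v"
    and c: "c \<in> set_pmf (marginal_at (pinned q R \<rho>) u)" "c' \<in> set_pmf (marginal_at (pinned q R \<rho>) u)"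
  shows "tv_dist (marginal_at (pinned_at (pinned q R \<rho>) u c) v)
           (marginal_at (pinned_at (pinned q R \<rho>) u c') v) \<le> influence q R \<rho> u v"
proof -
  let ?C = "set_pmf (marginal_at (pinned q R \<rho>) u)"
  let ?t = "\<lambda>(c, c'). tv_dist (marginal_at (pinned_at (pinned q R \<rho>) u c) v)
           (marginal_at (pinned_at (pinned q R \<rho>) u c') v)"
  have "finite ?C" using fin by (simp add: marginal_at_def)
  moreover have "{?t (c, c') | c c'. c \<in> ?C \<and> c' \<in> ?C} = ?t ` (?C \<times> ?C)" by auto
  ultimately show ?thesis
    using uv c by (auto simp: influence_def intro!: Max_ge)
qed

lemma influence_nonneg:
  assumes fin: "finite (set_pmf (pinned q R \<rho>))"
  shows "influence q R \<rho> u v \<ge> 0"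
proof (cases "u = v")
  case False
  obtain c where "c \<in> set_pmf (marginal_at (pinned q R \<rho>) u)"
    using set_pmf_not_empty[of "marginal_at (pinned q R \<rho>) u"] by blast
  from influence_ge[OF fin False this this] show ?thesis
    by (rule order_trans[OF tv_dist_nonneg])
qed (simp add: influence_def)

lemma mean_indicator:
  assumes "finite (set_pmf p)"
  shows "mean p (\<lambda>x. if x \<in> A then 1 else 0) = measure_pmf.prob p A"
proof -
  have "mean p (\<lambda>x. if x \<in> A then 1 else 0) = (\<Sum>x\<in>set_pmf p. if x \<in> A then pmf p x else 0)"
    unfolding mean_def by (intro sum.cong) auto
  also have "\<dots> = (\<Sum>x\<in>A \<inter> set_pmf p. pmf p x)"
    using assms by (simp add: sum.inter_restrict[symmetric] Int_commute)
  also have "\<dots> = measure_pmf.prob p (A \<inter> set_pmf p)"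
    using assms by (simp add: measure_measure_pmf_finite)
  finally show ?thesis by (simp add: measure_Int_set_pmf)
qed

lemma prob_cong_set_pmf:
  "(\<And>x. x \<in> set_pmf p \<Longrightarrow> x \<in> A \<longleftrightarrow> x \<in> B) \<Longrightarrow> measure_pmf.prob p A = measure_pmf.prob p B"
  by (intro measure_pmf.finite_measure_eq_AE) (auto simp: AE_measure_pmf_iff)

lemma pmf_marginal_at_pinned_at:
  assumes "c \<in> set_pmf (marginal_at p u)"
  shows "pmf (marginal_at (pinned_at p u c) v) d =
    measure_pmf.prob p {\<sigma>. \<sigma> u = c \<and> \<sigma> v = d} / measure_pmf.prob p {\<sigma>. \<sigma> u = c}"
proof -
  have ne: "set_pmf p \<inter> {\<sigma>. \<sigma> u = c} \<noteq> {}" using assms by (auto simp: marginal_at_def)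
  have "pmf (marginal_at (pinned_at p u c) v) d = measure_pmf.prob (cond_pmf p {\<sigma>. \<sigma> u = c}) {\<sigma>. \<sigma> v = d}"
    by (simp add: marginal_at_def pinned_at_def pmf_map vimage_def)
  also have "\<dots> = measure_pmf.prob p ({\<sigma>. \<sigma> u = c} \<inter> {\<sigma>. \<sigma> v = d}) / measure_pmf.prob p {\<sigma>. \<sigma> u = c}"
    using ne by (simp add: cond_pmf.rep_eq measure_pmf.emeasure_eq_measure measure_measure_pmf_not_zero)
  finally show ?thesis by (simp add: Collect_conj_eq)
qed

text \<open>With \<open>a\<close> the probability of spin \<open>+1\<close> at \<open>u\<close>, the
  covariance is \<open>a * (1 - a)\<close> times the difference of the probabilities of
  \<open>+1\<close> at \<open>v\<close> given the two spins at \<open>u\<close>. That difference is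
  at most the influence, and \<open>1 - a\<close> is bounded by 1; on the diagonal the covariance is
  \<open>a * (1 - a)\<close> itself.\<close>

lemma abs_cov_plus_le:
  fixes q :: "'v config pmf" and R \<rho>
  defines "p \<equiv> pinned q R \<rho>"
  assumes fin: "finite (set_pmf p)" and p: "set_pmf p \<subseteq> configs V" and u: "u \<in> V"
  shows "\<bar>cov p (plus_at u) (plus_at v)\<bar> \<le> mean p (plus_at u) * ((if u = v then 1 else 0) + influence q R \<rho> u v)"
proof -
  have mp: "mean p (plus_at w) = measure_pmf.prob p {\<sigma>. \<sigma> w = 1}" for w
    using mean_indicator[OF fin, of "{\<sigma>. \<sigma> w = 1}"] unfolding plus_at_def by simp
  have mpp: "mean p (\<lambda>\<sigma>. plus_at u \<sigma> * plus_at v \<sigma>) = measure_pmf.prob p {\<sigma>. \<sigma> u = 1 \<and> \<sigma> v = 1}"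
  proof -
    have "(\<lambda>\<sigma>. plus_at u \<sigma> * plus_at v \<sigma>) = (\<lambda>\<sigma>. if \<sigma> \<in> {\<sigma>. \<sigma> u = 1 \<and> \<sigma> v = 1} then 1 else 0)"
      by (auto simp: plus_at_def)
    then show ?thesis using mean_indicator[OF fin, of "{\<sigma>. \<sigma> u = 1 \<and> \<sigma> v = 1}"] by simp
  qed
  define a where "a = measure_pmf.prob p {\<sigma>. \<sigma> u = 1}"
  define s where "s = measure_pmf.prob p {\<sigma>. \<sigma> u = 1 \<and> \<sigma> v = 1}"
  define t where "t = measure_pmf.prob p {\<sigma>. \<sigma> u = -1 \<and> \<sigma> v = 1}"
  have \<psi>: "influence q R \<rho> u v \<ge> 0" using fin unfolding p_def by (rule influence_nonneg)
  have a01: "0 \<le> a" "a \<le> 1" by (auto simp: a_def)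
  show ?thesis
  proof (cases "u = v")
    case True
    have "s = a" by (simp add: s_def a_def True)
    then have "cov p (plus_at u) (plus_at v) = a * (1 - a)"
      unfolding cov_def mpp mp by (simp add: True[symmetric] a_def[symmetric] s_def[symmetric] algebra_simps)
    also have "\<bar>a * (1 - a)\<bar> \<le> a * 1" using a01 mult_left_mono[of "1 - a" 1 a] by (simp add: abs_mult)
    finally show ?thesis using True by (simp add: mp a_def influence_def)
  next
    case False
    have spin: "\<sigma> u = 1 \<or> \<sigma> u = -1" if "\<sigma> \<in> set_pmf p" for \<sigma>
    proof -
      have "\<sigma> u \<in> {-1, 1}" using that p u unfolding configs_def by (blast dest: PiE_mem)
      then show ?thesis by auto
    qed
    have au: "measure_pmf.prob p {\<sigma>. \<sigma> u = -1} = 1 - a"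
    proof -
      have "measure_pmf.prob p (UNIV - {\<sigma>. \<sigma> u = 1}) = 1 - a"
        unfolding a_def using measure_pmf.prob_compl[of "{\<sigma>. \<sigma> u = 1}" p] by simp
      moreover have "measure_pmf.prob p (UNIV - {\<sigma>. \<sigma> u = 1}) = measure_pmf.prob p {\<sigma>. \<sigma> u = -1}"
        by (rule prob_cong_set_pmf) (use spin in auto)
      ultimately show ?thesis by simp
    qed
    have av: "measure_pmf.prob p {\<sigma>. \<sigma> v = 1} = s + t"
    proof -
      have "measure_pmf.prob p {\<sigma>. \<sigma> v = 1}
        = measure_pmf.prob p ({\<sigma>. \<sigma> u = 1 \<and> \<sigma> v = 1} \<union> {\<sigma>. \<sigma> u = -1 \<and> \<sigma> v = 1})"
        by (rule prob_cong_set_pmf) (use spin in auto)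
      also have "\<dots> = s + t"
        unfolding s_def t_def by (rule measure_pmf.finite_measure_Union) auto
      finally show ?thesis .
    qed
    have sa: "0 \<le> s" "s \<le> a" by (auto simp: s_def a_def intro!: measure_pmf.finite_measure_mono)
    have ta: "0 \<le> t" "t \<le> 1 - a"
      unfolding au[symmetric] t_def by (auto intro!: measure_pmf.finite_measure_mono)
    have cv: "cov p (plus_at u) (plus_at v) = s - a * (s + t)"
      unfolding cov_def mpp mp av by (simp add: s_def a_def)
    show ?thesis
    \<comment> \<open>If the spin at \<open>u\<close> is frozen, one of the two conditionings is
      meaningless, but then the covariance vanishes.\<close>
    proof (cases "a = 0 \<or> a = 1")
      case True
      then have "cov p (plus_at u) (plus_at v) = 0" using sa ta cv by auto
      then show ?thesis using \<psi> a01 by (simp add: mp a_def)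
    next
      case False2: False
      have c1: "1 \<in> set_pmf (marginal_at p u)" "-1 \<in> set_pmf (marginal_at p u)"
      proof -
        have "pmf (marginal_at p u) 1 = a" "pmf (marginal_at p u) (-1) = 1 - a"
          by (auto simp: marginal_at_def pmf_map vimage_def a_def au[unfolded a_def])
        then show "1 \<in> set_pmf (marginal_at p u)" "-1 \<in> set_pmf (marginal_at p u)"
          using False2 by (auto simp: set_pmf_iff)
      qed
      have fins: "finite (set_pmf (marginal_at (pinned_at p u c) v))" if "c \<in> set_pmf (marginal_at p u)" for c
      proof -
        have "set_pmf p \<inter> {\<sigma>. \<sigma> u = c} \<noteq> {}" using that by (auto simp: marginal_at_def)
        then show ?thesis using fin by (simp add: marginal_at_def pinned_at_def set_cond_pmf)
      qed
      have "\<bar>s / a - t / (1 - a)\<bar> = \<bar>pmf (marginal_at (pinned_at p u 1) v) 1 - pmf (marginal_at (pinned_at p u (-1)) v) 1\<bar>"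
        by (simp add: pmf_marginal_at_pinned_at[OF c1(1)] pmf_marginal_at_pinned_at[OF c1(2)] au
             a_def[symmetric] s_def[symmetric] t_def[symmetric])
      also have "\<dots> \<le> tv_dist (marginal_at (pinned_at p u 1) v) (marginal_at (pinned_at p u (-1)) v)"
        by (rule abs_pmf_diff_le_tv_dist) (intro fins c1)+
      also have "\<dots> \<le> influence q R \<rho> u v"
        using fin c1 unfolding p_def by (intro influence_ge False)
      finally have le: "\<bar>s / a - t / (1 - a)\<bar> \<le> influence q R \<rho> u v" .
      have "s - a * (s + t) = a * (1 - a) * (s / a - t / (1 - a))"
        using False2 by (simp add: field_simps)
      then have "\<bar>cov p (plus_at u) (plus_at v)\<bar> = a * (1 - a) * \<bar>s / a - t / (1 - a)\<bar>"
        using a01 by (simp add: cv abs_mult)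
      also have "\<dots> \<le> a * 1 * influence q R \<rho> u v"
        using a01 le by (intro mult_mono) auto
      finally show ?thesis using False by (simp add: mp a_def)
    qed
  qed
qed

text \<open>Schur's test bounds the covariance matrix of the indicators by \<open>1 + \<eta>\<close>
  times the diagonal of their means, and \<open>sum_cov_squares_le\<close> turns this into a bound
  for an arbitrary \<open>f\<close>.\<close>

lemma spectrally_independent_sum_cov_squares_le:
  fixes q :: "'v config pmf" and R \<rho>
  defines "p \<equiv> pinned q R \<rho>"
  assumes V: "finite V" and p: "set_pmf p \<subseteq> configs V" and \<eta>: "\<eta> > 0"
    and si: "spectrally_independent V \<eta> q" and R: "R \<subseteq> V" "feasible q R \<rho>"
  shows "(\<Sum>v\<in>V - R. (cov p f (plus_at v))\<^sup>2 / mean p (plus_at v)) \<le> (1 + \<eta>) * var p f"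
proof (rule sum_cov_squares_le)
  show fin: "finite (set_pmf p)" using finite_set_pmf_configs[OF V p] .
  show "1 + \<eta> > 0" using \<eta> by simp
  show "cov p f (plus_at v) = 0" if "mean p (plus_at v) = 0" for v
  proof -
    have "pmf p \<sigma> * plus_at v \<sigma> = 0" if "\<sigma> \<in> set_pmf p" for \<sigma>
      using \<open>mean p (plus_at v) = 0\<close> that fin unfolding mean_def
      by (subst (asm) sum_nonneg_eq_0_iff) (auto simp: plus_at_def)
    then have "mean p (\<lambda>\<sigma>. f \<sigma> * plus_at v \<sigma>) = 0" by (auto simp: mean_def set_pmf_iff)
    then show ?thesis using that by (simp add: cov_def)
  qed
  show "(\<Sum>u\<in>V - R. \<Sum>v\<in>V - R. cov p (plus_at u) (plus_at v) * x u * x v)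
      \<le> (1 + \<eta>) * (\<Sum>u\<in>V - R. mean p (plus_at u) * (x u)\<^sup>2)" for x
  proof (rule quadratic_form_le_of_spectral_radius)
    show "spectral_radius_on (V - R) (influence q R \<rho>) \<le> \<eta>"
      using si R by (simp add: spectrally_independent_def)
    show "\<bar>cov p (plus_at u) (plus_at v)\<bar> \<le> mean p (plus_at u) * ((if u = v then 1 else 0) + influence q R \<rho> u v)"
      if "u \<in> V - R" for u v
      using abs_cov_plus_le[of q R \<rho> V u v] fin p that unfolding p_def by blast
    show "influence q R \<rho> u v \<ge> 0" for u v
      using fin unfolding p_def by (rule influence_nonneg)
    show "mean p (plus_at u) \<ge> 0" for u
      by (rule mean_nonneg) (simp add: plus_at_def)
    show "cov p (plus_at u) (plus_at v) = cov p (plus_at v) (plus_at u)" for u v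
      by (rule cov_commute)
  qed (use V in simp)
qed

section \<open>Decay of variance along the localization\<close>

definition pluses :: "'v set \<Rightarrow> 'v config \<Rightarrow> 'v set" where
  "pluses V \<sigma> = {v \<in> V. \<sigma> v = 1}"

text \<open>The unnormalised expectation of \<open>g\<close> under the tilt of \<open>\<mu>\<close> by \<open>t\<close>, restricted to the
  configurations that are \<open>+1\<close> on \<open>R\<close>; the sites of \<open>R\<close> carry no factor \<open>t\<close>.\<close>

definition psum :: "'v set \<Rightarrow> 'v config pmf \<Rightarrow> ('v config \<Rightarrow> real) \<Rightarrow> 'v set \<Rightarrow> real \<Rightarrow> real" where
  "psum V \<mu> g R t =
     (\<Sum>\<sigma>\<in>set_pmf \<mu>. if R \<subseteq> pluses V \<sigma> then pmf \<mu> \<sigma> * g \<sigma> * t ^ card (pluses V \<sigma> - R) else 0)"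

text \<open>The variance of \<open>f\<close> under the pinned tilt, multiplied by its normalising
  sum, see \<open>var_pinned_plus\<close>. For infeasible \<open>R\<close> it is 0.\<close>

definition local_var ::
  "'v set \<Rightarrow> 'v config pmf \<Rightarrow> ('v config \<Rightarrow> real) \<Rightarrow> 'v set \<Rightarrow> real \<Rightarrow> real" where
  "local_var V \<mu> f R t = psum V \<mu> (\<lambda>\<sigma>. (f \<sigma>)\<^sup>2) R t - (psum V \<mu> f R t)\<^sup>2 / psum V \<mu> (\<lambda>_. 1) R t"

text \<open>With \<open>E = A / Z\<close> and \<open>E' = A' / Z'\<close> this is \<open>Z' * (E' - E)\<^sup>2\<close>; written out, it also vanishes
  when \<open>R\<close> is infeasible.\<close>

definition jump ::
  "'v set \<Rightarrow> 'v config pmf \<Rightarrow> ('v config \<Rightarrow> real) \<Rightarrow> 'v set \<Rightarrow> real \<Rightarrow> 'v \<Rightarrow> real" where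
  "jump V \<mu> f R t v =
     (let A = psum V \<mu> f R t; A' = psum V \<mu> f (insert v R) t;
          Z = psum V \<mu> (\<lambda>_. 1) R t; Z' = psum V \<mu> (\<lambda>_. 1) (insert v R) t
      in A'\<^sup>2 / Z' - 2 * A * A' / Z + A\<^sup>2 * Z' / Z\<^sup>2)"

text \<open>The function \<open>G\<close> of the localization: \<open>(1 - t) ^ card R\<close> times
  the normalising sum inside \<open>local_var\<close> is the probability of revealing exactly
  \<open>R\<close>.\<close>

definition total_local_var ::
  "'v set \<Rightarrow> 'v config pmf \<Rightarrow> ('v config \<Rightarrow> real) \<Rightarrow> real \<Rightarrow> real" where
  "total_local_var V \<mu> f t = (\<Sum>R\<in>Pow V. (1 - t) ^ card R * local_var V \<mu> f R t)"

lemma finite_pluses: "finite V \<Longrightarrow> finite (pluses V \<sigma>)"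
  by (simp add: pluses_def)

lemma psum_eq_0: "\<not> (\<exists>\<sigma>\<in>set_pmf \<mu>. R \<subseteq> pluses V \<sigma>) \<Longrightarrow> psum V \<mu> g R t = 0"
  unfolding psum_def by (rule sum.neutral) auto

text \<open>Double counting of pairs of a set and a marked element: removing the marked element from
  \<open>R\<close> is a bijection onto pairs with the element outside. The truncated subtraction at
  the empty set is harmless, its factor \<open>card R\<close> being 0.\<close>

lemma sum_subsets_insert:
  fixes h :: "'a set \<Rightarrow> real" and c :: "nat \<Rightarrow> real"
  assumes V: "finite V"
  shows "(\<Sum>R\<in>Pow V. card R * c (card R - 1) * h R)
       = (\<Sum>R\<in>Pow V. c (card R) * (\<Sum>v\<in>V - R. h (insert v R)))"
proof -
  have "(\<Sum>R\<in>Pow V. card R * c (card R - 1) * h R) = (\<Sum>R\<in>Pow V. \<Sum>v\<in>R. c (card R - 1) * h R)"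
    by (simp add: algebra_simps)
  also have "\<dots> = (\<Sum>(R, v)\<in>Sigma (Pow V) (\<lambda>R. R). c (card R - 1) * h R)"
    using V by (subst sum.Sigma) (auto intro: finite_subset)
  also have "\<dots> = (\<Sum>(R, v)\<in>Sigma (Pow V) (\<lambda>R. V - R). c (card R) * h (insert v R))"
    by (rule sum.reindex_bij_witness[of _ "\<lambda>(R, v). (insert v R, v)" "\<lambda>(R, v). (R - {v}, v)"])
      (auto simp: insert_absorb card_Diff_singleton)
  also have "\<dots> = (\<Sum>R\<in>Pow V. \<Sum>v\<in>V - R. c (card R) * h (insert v R))"
    using V by (subst sum.Sigma) auto
  finally show ?thesis by (simp add: sum_distrib_left)
qed

text \<open>Expansion of the product over \<open>S\<close> of \<open>(1 - t) + t\<close>: each site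
  is revealed or not.\<close>

lemma sum_subsets_binomial:
  fixes t :: real
  assumes S: "finite S"
  shows "(\<Sum>R\<in>Pow S. (1 - t) ^ card R * t ^ card (S - R)) = 1"
  using prod_add[OF S, of "\<lambda>_. 1 - t" "\<lambda>_. t"] by simp

section \<open>Partial sums over revealed sets and their derivatives in \<open>t\<close>\<close>

context
  fixes V :: "'v set" and \<mu> :: "'v config pmf"
  assumes V: "finite V" and fin: "finite (set_pmf \<mu>)"
begin

text \<open>A plus at \<open>v\<close> outside \<open>R\<close> carries a factor \<open>t\<close>,
  which disappears once \<open>v\<close> is revealed.\<close>

lemma psum_insert:
  assumes v: "v \<in> V - R"
  shows "psum V \<mu> (\<lambda>\<sigma>. g \<sigma> * plus_at v \<sigma>) R t = t * psum V \<mu> g (insert v R) t"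
  unfolding psum_def sum_distrib_left
proof (intro sum.cong refl)
  fix \<sigma>
  have "t ^ card (pluses V \<sigma> - R) = t * t ^ card (pluses V \<sigma> - insert v R)" if "v \<in> pluses V \<sigma>"
  proof -
    have "pluses V \<sigma> - R = insert v (pluses V \<sigma> - insert v R)" using that v by auto
    then have "card (pluses V \<sigma> - R) = Suc (card (pluses V \<sigma> - insert v R))"
      using finite_pluses[OF V, of \<sigma>] by (metis card_insert_disjoint finite_Diff Diff_iff insertI1)
    then show ?thesis by simp
  qed
  then show "(if R \<subseteq> pluses V \<sigma> then pmf \<mu> \<sigma> * (g \<sigma> * plus_at v \<sigma>) * t ^ card (pluses V \<sigma> - R) else 0) =
     t * (if insert v R \<subseteq> pluses V \<sigma> then pmf \<mu> \<sigma> * g \<sigma> * t ^ card (pluses V \<sigma> - insert v R) else 0)"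
    using v by (auto simp: plus_at_def pluses_def)
qed

lemma psum_pos_iff:
  assumes "t > 0"
  shows "psum V \<mu> (\<lambda>_. 1) R t > 0 \<longleftrightarrow> (\<exists>\<sigma>\<in>set_pmf \<mu>. R \<subseteq> pluses V \<sigma>)"
proof
  assume "psum V \<mu> (\<lambda>_. 1) R t > 0"
  then show "\<exists>\<sigma>\<in>set_pmf \<mu>. R \<subseteq> pluses V \<sigma>"
    by (rule contrapos_pp) (simp add: psum_eq_0)
next
  assume "\<exists>\<sigma>\<in>set_pmf \<mu>. R \<subseteq> pluses V \<sigma>"
  then obtain \<sigma> where "\<sigma> \<in> set_pmf \<mu>" "R \<subseteq> pluses V \<sigma>" by blast
  then show "psum V \<mu> (\<lambda>_. 1) R t > 0"
    unfolding psum_def using assms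
    by (intro sum_pos2[OF fin, of \<sigma>]) (auto simp: pmf_positive)
qed

text \<open>Law of total expectation: given \<open>\<sigma>\<close>, the probabilities of the
  possible revealed subsets of its pluses add up to 1.\<close>

lemma psum_total: "(\<Sum>R\<in>Pow V. (1 - t) ^ card R * psum V \<mu> g R t) = mean \<mu> g"
proof -
  have "(\<Sum>R\<in>Pow V. (1 - t) ^ card R * psum V \<mu> g R t)
    = (\<Sum>R\<in>Pow V. \<Sum>\<sigma>\<in>set_pmf \<mu>. pmf \<mu> \<sigma> * g \<sigma> *
         (if R \<subseteq> pluses V \<sigma> then (1 - t) ^ card R * t ^ card (pluses V \<sigma> - R) else 0))"
    unfolding psum_def sum_distrib_left by (intro sum.cong refl) auto
  also have "\<dots> = (\<Sum>\<sigma>\<in>set_pmf \<mu>. \<Sum>R\<in>Pow V. pmf \<mu> \<sigma> * g \<sigma> *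
         (if R \<subseteq> pluses V \<sigma> then (1 - t) ^ card R * t ^ card (pluses V \<sigma> - R) else 0))"
    by (rule sum.swap)
  also have "\<dots> = (\<Sum>\<sigma>\<in>set_pmf \<mu>. pmf \<mu> \<sigma> * g \<sigma>)"
  proof (intro sum.cong refl)
    fix \<sigma>
    have "(\<Sum>R\<in>Pow V. if R \<subseteq> pluses V \<sigma> then (1 - t) ^ card R * t ^ card (pluses V \<sigma> - R) else 0)
      = (\<Sum>R\<in>Pow (pluses V \<sigma>). (1 - t) ^ card R * t ^ card (pluses V \<sigma> - R))"
      using V by (intro sum.mono_neutral_cong_right) (auto simp: pluses_def)
    then show "(\<Sum>R\<in>Pow V. pmf \<mu> \<sigma> * g \<sigma> *
         (if R \<subseteq> pluses V \<sigma> then (1 - t) ^ card R * t ^ card (pluses V \<sigma> - R) else 0)) = pmf \<mu> \<sigma> * g \<sigma>"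
      unfolding sum_distrib_left[symmetric]
      using sum_subsets_binomial[OF finite_pluses[OF V, of \<sigma>], of t] by simp
  qed
  finally show ?thesis by (simp add: mean_def)
qed

text \<open>Differentiating the power of \<open>t\<close> gives one equal term for each unrevealed
  plus \<open>v\<close>, and that term belongs to the revealed set
  \<open>insert v R\<close>.\<close>

lemma psum_deriv:
  assumes R: "R \<subseteq> V"
  shows "(psum V \<mu> g R has_real_derivative (\<Sum>v\<in>V - R. psum V \<mu> g (insert v R) t)) (at t)"
proof -
  let ?d = "\<lambda>\<sigma>. if R \<subseteq> pluses V \<sigma> then pmf \<mu> \<sigma> * g \<sigma> *
      (card (pluses V \<sigma> - R) * t ^ (card (pluses V \<sigma> - R) - 1)) else 0"
  have "(psum V \<mu> g R has_real_derivative (\<Sum>\<sigma>\<in>set_pmf \<mu>. ?d \<sigma>)) (at t)"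
    unfolding psum_def
    by (rule DERIV_sum) (auto intro!: derivative_eq_intros)
  also have "(\<Sum>\<sigma>\<in>set_pmf \<mu>. ?d \<sigma>) = (\<Sum>\<sigma>\<in>set_pmf \<mu>. \<Sum>v\<in>V - R.
      if insert v R \<subseteq> pluses V \<sigma> then pmf \<mu> \<sigma> * g \<sigma> * t ^ card (pluses V \<sigma> - insert v R) else 0)"
  proof (intro sum.cong refl)
    fix \<sigma>
    show "?d \<sigma> = (\<Sum>v\<in>V - R. if insert v R \<subseteq> pluses V \<sigma> then pmf \<mu> \<sigma> * g \<sigma> * t ^ card (pluses V \<sigma> - insert v R) else 0)"
    proof (cases "R \<subseteq> pluses V \<sigma>")
      case True
      have "(\<Sum>v\<in>V - R. if insert v R \<subseteq> pluses V \<sigma> then pmf \<mu> \<sigma> * g \<sigma> * t ^ card (pluses V \<sigma> - insert v R) else 0)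
        = (\<Sum>v\<in>pluses V \<sigma> - R. pmf \<mu> \<sigma> * g \<sigma> * t ^ card (pluses V \<sigma> - insert v R))"
        using V True by (intro sum.mono_neutral_cong_right) (auto simp: pluses_def)
      also have "\<dots> = (\<Sum>v\<in>pluses V \<sigma> - R. pmf \<mu> \<sigma> * g \<sigma> * t ^ (card (pluses V \<sigma> - R) - 1))"
      proof (intro sum.cong refl)
        fix v assume v: "v \<in> pluses V \<sigma> - R"
        have "pluses V \<sigma> - insert v R = (pluses V \<sigma> - R) - {v}" by auto
        then show "pmf \<mu> \<sigma> * g \<sigma> * t ^ card (pluses V \<sigma> - insert v R)
          = pmf \<mu> \<sigma> * g \<sigma> * t ^ (card (pluses V \<sigma> - R) - 1)"
          using v finite_pluses[OF V, of \<sigma>] by (simp add: card_Diff_singleton)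
      qed
      finally show ?thesis using True by simp
    qed simp
  qed
  also have "\<dots> = (\<Sum>v\<in>V - R. psum V \<mu> g (insert v R) t)"
    unfolding psum_def by (rule sum.swap)
  finally show ?thesis .
qed

text \<open>The quotient rule, arranged so that the quotient for \<open>insert v R\<close> appears
  explicitly; \<open>jump\<close> is what remains. For infeasible \<open>R\<close> everything is 0,
  quotients included.\<close>

lemma psum_square_quotient_deriv:
  assumes t: "t > 0" and R: "R \<subseteq> V"
  shows "((\<lambda>t. (psum V \<mu> f R t)\<^sup>2 / psum V \<mu> (\<lambda>_. 1) R t) has_real_derivative
     (\<Sum>v\<in>V - R. (psum V \<mu> f (insert v R) t)\<^sup>2 / psum V \<mu> (\<lambda>_. 1) (insert v R) t - jump V \<mu> f R t v)) (at t)"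
proof (cases "\<exists>\<sigma>\<in>set_pmf \<mu>. R \<subseteq> pluses V \<sigma>")
  case True
  let ?A = "psum V \<mu> f R t" and ?Z = "psum V \<mu> (\<lambda>_. 1) R t"
  let ?dA = "\<Sum>v\<in>V - R. psum V \<mu> f (insert v R) t"
  let ?dZ = "\<Sum>v\<in>V - R. psum V \<mu> (\<lambda>_. 1) (insert v R) t"
  have "?Z > 0" using True psum_pos_iff[OF t, of R] by blast
  then have Z: "?Z \<noteq> 0" by simp
  note dA = psum_deriv[OF R, of f t] and dZ = psum_deriv[OF R, of "\<lambda>_. 1" t]
  have "((\<lambda>t. (psum V \<mu> f R t)\<^sup>2 / psum V \<mu> (\<lambda>_. 1) R t) has_real_derivative
      (2 * ?A * ?dA / ?Z - ?A\<^sup>2 * ?dZ / ?Z\<^sup>2)) (at t)"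
    by (rule DERIV_cong[OF DERIV_divide[OF DERIV_power[OF dA, of 2] dZ Z]])
      (use Z in \<open>simp add: field_simps power2_eq_square\<close>)
  also have "2 * ?A * ?dA / ?Z - ?A\<^sup>2 * ?dZ / ?Z\<^sup>2 = (\<Sum>v\<in>V - R.
      (psum V \<mu> f (insert v R) t)\<^sup>2 / psum V \<mu> (\<lambda>_. 1) (insert v R) t - jump V \<mu> f R t v)"
    by (simp add: jump_def Let_def sum_subtractf sum_distrib_left sum_divide_distrib)
  finally show ?thesis .
next
  case False
  then have "\<not> (\<exists>\<sigma>\<in>set_pmf \<mu>. insert v R \<subseteq> pluses V \<sigma>)" for v by auto
  then show ?thesis using False by (simp add: psum_eq_0 jump_def)
qed

lemma total_local_var_deriv:
  assumes t: "t > 0"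
  shows "(total_local_var V \<mu> f has_real_derivative
           (\<Sum>R\<in>Pow V. (1 - t) ^ card R * (\<Sum>v\<in>V - R. jump V \<mu> f R t v))) (at t)"
proof -
  let ?h = "\<lambda>R t. (psum V \<mu> f R t)\<^sup>2 / psum V \<mu> (\<lambda>_. 1) R t"
  let ?d = "\<lambda>R. \<Sum>v\<in>V - R. ?h (insert v R) t - jump V \<mu> f R t v"
  \<comment> \<open>The expected second moment does not depend on \<open>t\<close> by
    \<open>psum_total\<close>, so only the squared conditional means have to be
    differentiated.\<close>
  have eq: "total_local_var V \<mu> f t = mean \<mu> (\<lambda>\<sigma>. (f \<sigma>)\<^sup>2) - (\<Sum>R\<in>Pow V. (1 - t) ^ card R * ?h R t)" for t
    by (simp add: total_local_var_def local_var_def right_diff_distrib sum_subtractf psum_total)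
  have "(total_local_var V \<mu> f has_real_derivative
      - (\<Sum>R\<in>Pow V. (1 - t) ^ card R * ?d R - card R * (1 - t) ^ (card R - 1) * ?h R t)) (at t)"
  proof -
    have "((\<lambda>t. (1 - t) ^ card R * ?h R t) has_real_derivative
        (1 - t) ^ card R * ?d R - card R * (1 - t) ^ (card R - 1) * ?h R t) (at t)" if "R \<in> Pow V" for R
    proof -
      have "((\<lambda>t. (1 - t) ^ card R) has_real_derivative - (card R * (1 - t) ^ (card R - 1))) (at t)"
        by (auto intro!: derivative_eq_intros)
      from DERIV_mult[OF this psum_square_quotient_deriv[OF t, of R f]] that
      have "((\<lambda>t. (1 - t) ^ card R * ?h R t) has_real_derivative
        - (card R * (1 - t) ^ (card R - 1)) * ?h R t + ?d R * (1 - t) ^ card R) (at t)" by blast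
      then show ?thesis by (rule DERIV_cong) (simp add: mult.commute)
    qed
    then have "((\<lambda>t. \<Sum>R\<in>Pow V. (1 - t) ^ card R * ?h R t) has_real_derivative
      (\<Sum>R\<in>Pow V. (1 - t) ^ card R * ?d R - card R * (1 - t) ^ (card R - 1) * ?h R t)) (at t)"
      by (rule DERIV_sum)
    from DERIV_diff[OF DERIV_const[of "mean \<mu> (\<lambda>\<sigma>. (f \<sigma>)\<^sup>2)"] this] show ?thesis
      unfolding eq[abs_def] diff_0 .
  qed
  also have "- (\<Sum>R\<in>Pow V. (1 - t) ^ card R * ?d R - card R * (1 - t) ^ (card R - 1) * ?h R t)
    = (\<Sum>R\<in>Pow V. card R * (1 - t) ^ (card R - 1) * ?h R t) - (\<Sum>R\<in>Pow V. (1 - t) ^ card R * ?d R)"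
    by (simp add: sum_subtractf)
  \<comment> \<open>Differentiating the weights produces, after double counting, the same quotients
    for \<open>insert v R\<close> as differentiating the summands. They cancel, and only the jumps
    survive.\<close>
  also have "(\<Sum>R\<in>Pow V. card R * (1 - t) ^ (card R - 1) * ?h R t)
    = (\<Sum>R\<in>Pow V. (1 - t) ^ card R * (\<Sum>v\<in>V - R. ?h (insert v R) t))"
    by (rule sum_subsets_insert[OF V, where c = "\<lambda>k. (1 - t) ^ k"])
  also have "\<dots> - (\<Sum>R\<in>Pow V. (1 - t) ^ card R * ?d R)
    = (\<Sum>R\<in>Pow V. (1 - t) ^ card R * (\<Sum>v\<in>V - R. jump V \<mu> f R t v))"
    unfolding sum_subtractf[symmetric] right_diff_distrib[symmetric] by simp
  finally show ?thesis .
qed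

text \<open>At \<open>t = 1\<close> nothing is revealed: the weight is \<open>0 ^ card R\<close>,
  which is 1 for the empty set and 0 otherwise.\<close>

lemma total_local_var_1: "total_local_var V \<mu> f 1 = var \<mu> f"
proof -
  have "total_local_var V \<mu> f 1 = (\<Sum>R\<in>Pow V. if R = {} then local_var V \<mu> f R 1 else 0)"
    unfolding total_local_var_def using V
    by (intro sum.cong refl) (auto simp: power_0_left dest: finite_subset)
  also have "\<dots> = local_var V \<mu> f {} 1" using V by simp
  also have "\<dots> = var \<mu> f"
    by (simp add: local_var_def psum_def mean_def[symmetric] var_eq[OF fin] sum_set_pmf[OF fin])
  finally show ?thesis .
qed

text \<open>A Gronwall argument along the localization: \<open>t powr (-L) * total_local_var V \<mu> f t\<close> is
  nonincreasing.\<close>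

lemma var_le_total_local_var:
  assumes \<theta>: "0 < \<theta>" "\<theta> < 1"
    and jump: "\<And>R t. R \<subseteq> V \<Longrightarrow> 0 < t \<Longrightarrow> t \<le> 1 \<Longrightarrow> (\<Sum>v\<in>V - R. jump V \<mu> f R t v) \<le> L / t * local_var V \<mu> f R t"
  shows "\<theta> powr L * var \<mu> f \<le> total_local_var V \<mu> f \<theta>"
proof -
  let ?G = "total_local_var V \<mu> f"
  have "1 powr (- L) * ?G 1 \<le> \<theta> powr (- L) * ?G \<theta>"
  proof (rule DERIV_nonpos_imp_nonincreasing[where f = "\<lambda>t. t powr (- L) * ?G t"])
    fix t assume t: "\<theta> \<le> t" "t \<le> 1"
    then have t0: "t > 0" using \<theta> by simp
    let ?d = "\<Sum>R\<in>Pow V. (1 - t) ^ card R * (\<Sum>v\<in>V - R. jump V \<mu> f R t v)"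
    have "?d \<le> (\<Sum>R\<in>Pow V. (1 - t) ^ card R * (L / t * local_var V \<mu> f R t))"
      using t t0 jump by (intro sum_mono mult_left_mono) auto
    also have "\<dots> = L / t * ?G t"
      by (simp add: total_local_var_def sum_distrib_left algebra_simps)
    finally have d: "?d \<le> L / t * ?G t" .
    have "((\<lambda>t. t powr (- L) * ?G t) has_real_derivative
        t powr (- L) * (?d - L / t * ?G t)) (at t)"
      by (rule DERIV_cong[OF DERIV_mult[OF has_real_derivative_powr[OF t0] total_local_var_deriv[OF t0]]])
        (use t0 in \<open>simp add: powr_diff field_simps\<close>)
    moreover have "t powr (- L) * (?d - L / t * ?G t) \<le> 0"
      using d by (intro mult_nonneg_nonpos) auto
    ultimately show "\<exists>y. ((\<lambda>t. t powr (- L) * ?G t) has_real_derivative y) (at t) \<and> y \<le> 0"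
      by blast
  qed (use \<theta> in simp)
  then have "\<theta> powr L * var \<mu> f \<le> \<theta> powr L * (\<theta> powr (- L) * ?G \<theta>)"
    by (intro mult_left_mono) (auto simp: total_local_var_1)
  also have "\<dots> = ?G \<theta>" using \<theta> by (simp add: powr_minus)
  finally show ?thesis .
qed

end

section \<open>Comparison of spectral gaps\<close>

lemma mean_superset:
  assumes "finite S" "set_pmf p \<subseteq> S"
  shows "mean p g = (\<Sum>x\<in>S. pmf p x * g x)"
  unfolding mean_def using assms by (intro sum.mono_neutral_left) (auto simp: set_pmf_iff)

text \<open>Only finitely many feasible pinnings exist, so \<open>Min\<close> is a true minimum. The
  upper bound 1 comes from pinning all of \<open>V\<close>, which leaves a single state with gap
  1.\<close>

lemma gap_GD_min_bounds:
  fixes V :: "'v set" and q :: "'v config pmf"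
  assumes V: "finite V" and q: "set_pmf q \<subseteq> configs V"
  shows "0 \<le> gap_GD_min V q" "gap_GD_min V q \<le> 1"
    and "\<And>R \<rho>. R \<subseteq> V \<Longrightarrow> feasible q R \<rho> \<Longrightarrow> gap_GD_min V q \<le> gap_GD V (pinned q R \<rho>)"
proof -
  define X where "X = {(\<Lambda>, \<tau>). \<Lambda> \<subseteq> V \<and> feasible q \<Lambda> \<tau>}"
  define g where "g = (\<lambda>(\<Lambda>, \<tau>). gap_GD V (pinned q \<Lambda> \<tau>))"
  have eq: "{gap_GD V (pinned q \<Lambda> \<tau>) | \<Lambda> \<tau>. \<Lambda> \<subseteq> V \<and> feasible q \<Lambda> \<tau>} = g ` X"
    by (auto simp: X_def g_def)
  have finq: "finite (set_pmf q)" using finite_set_pmf_configs[OF V q] .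
  have "X \<subseteq> (\<Union>\<Lambda>\<in>Pow V. {\<Lambda>} \<times> (\<lambda>\<sigma>. restrict \<sigma> \<Lambda>) ` set_pmf q)"
    by (auto simp: X_def feasible_def marginal_def)
  moreover have "finite (\<Union>\<Lambda>\<in>Pow V. {\<Lambda>} \<times> (\<lambda>\<sigma>. restrict \<sigma> \<Lambda>) ` set_pmf q)"
    using V finq by simp
  ultimately have fin: "finite (g ` X)" using finite_subset by blast
  obtain \<sigma> where \<sigma>: "\<sigma> \<in> set_pmf q" using set_pmf_not_empty[of q] by blast
  have full: "(V, restrict \<sigma> V) \<in> X"
    using \<sigma> by (auto simp: X_def feasible_def marginal_def)
  have "set_pmf (pinned q V (restrict \<sigma> V)) = set_pmf q \<inter> {\<tau>. restrict \<tau> V = restrict \<sigma> V}"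
    unfolding pinned_def using \<sigma> by (intro set_cond_pmf) auto
  also have "\<dots> = {\<sigma>}"
  proof -
    have "restrict \<tau> V = \<tau>" if "\<tau> \<in> set_pmf q" for \<tau>
      using that q by (auto simp: configs_def)
    then show ?thesis using \<sigma> by force
  qed
  finally have "g (V, restrict \<sigma> V) = 1" by (simp add: g_def gap_GD_def)
  then show "gap_GD_min V q \<le> 1"
    unfolding gap_GD_min_def eq using fin full by (metis Min_le imageI)
  have "0 \<le> x" if x: "x \<in> g ` X" for x
  proof -
    obtain \<Lambda> \<tau> where x: "x = gap_GD V (pinned q \<Lambda> \<tau>)" "feasible q \<Lambda> \<tau>"
      using x by (auto simp: X_def g_def)
    then have "set_pmf (pinned q \<Lambda> \<tau>) \<subseteq> set_pmf q"
      by (subst pinned_def, subst set_cond_pmf) (auto simp: feasible_def marginal_def)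
    then show ?thesis using x q gap_GD_nonneg[OF V, of "pinned q \<Lambda> \<tau>"] by blast
  qed
  then show "0 \<le> gap_GD_min V q"
    unfolding gap_GD_min_def eq using fin full by (subst Min_ge_iff) auto
  show "gap_GD_min V q \<le> gap_GD V (pinned q R \<rho>)" if "R \<subseteq> V" "feasible q R \<rho>" for R \<rho>
    unfolding gap_GD_min_def eq using fin that by (intro Min_le) (auto simp: X_def g_def)
qed

section \<open>Pinned tilts expressed through partial sums\<close>

context
  fixes V :: "'v set" and \<mu> :: "'v config pmf" and t :: real and R :: "'v set"
  assumes V: "finite V" and \<mu>: "set_pmf \<mu> \<subseteq> configs V" and t: "t > 0"
    and R: "R \<subseteq> V" and occurs: "\<exists>\<sigma>\<in>set_pmf \<mu>. R \<subseteq> pluses V \<sigma>"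
begin

abbreviation (input) "tilted \<equiv> tilt V (\<lambda>_. t) \<mu>"
abbreviation (input) "pinned_plus \<equiv> pinned tilted R (restrict (\<lambda>_. 1) R)"
abbreviation (input) "Z \<equiv> psum V \<mu> (\<lambda>_. 1) R t"

lemma pmf_tilt_const:
  "pmf tilted \<sigma> = pmf \<mu> \<sigma> * t ^ card (pluses V \<sigma>) / (\<Sum>\<sigma>'\<in>set_pmf \<mu>. pmf \<mu> \<sigma>' * t ^ card (pluses V \<sigma>'))"
  using pmf_tilt[OF finite_set_pmf_configs[OF V \<mu>], of V "\<lambda>_. t"] t
  by (simp add: tilt_weight_def pluses_def)

lemma set_pmf_tilt: "set_pmf tilted = set_pmf \<mu>"
proof -
  have "(\<Sum>\<sigma>'\<in>set_pmf \<mu>. pmf \<mu> \<sigma>' * t ^ card (pluses V \<sigma>')) > 0"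
    using t by (intro sum_pos finite_set_pmf_configs[OF V \<mu>] set_pmf_not_empty) (auto simp: pmf_positive)
  then show ?thesis using t by (auto simp: set_pmf_iff pmf_tilt_const)
qed

lemma restrict_eq_plus_iff: "restrict \<sigma> R = restrict (\<lambda>_. 1) R \<longleftrightarrow> R \<subseteq> pluses V \<sigma>"
  using R by (auto simp: pluses_def restrict_def fun_eq_iff)

lemma feasible_plus: "feasible tilted R (restrict (\<lambda>_. 1) R)"
  using occurs restrict_eq_plus_iff
  by (auto simp: feasible_def marginal_def set_pmf_tilt image_iff) metis

lemma Z_pos: "Z > 0"
  using psum_pos_iff[OF V finite_set_pmf_configs[OF V \<mu>] t] occurs by blast

text \<open>All configurations that are \<open>+1\<close> on \<open>R\<close> share the factor
  \<open>t ^ card R\<close>, which cancels on conditioning together with the normalisation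
  \<open>N\<close> of the tilt.\<close>

lemma pmf_pinned_plus:
  "pmf pinned_plus \<sigma> = (if R \<subseteq> pluses V \<sigma> then pmf \<mu> \<sigma> * t ^ card (pluses V \<sigma> - R) / Z else 0)"
proof -
  define N where "N = (\<Sum>\<sigma>'\<in>set_pmf \<mu>. pmf \<mu> \<sigma>' * t ^ card (pluses V \<sigma>'))"
  have fin: "finite (set_pmf \<mu>)" using finite_set_pmf_configs[OF V \<mu>] .
  have N: "N > 0"
    unfolding N_def using t by (intro sum_pos fin set_pmf_not_empty) (auto simp: pmf_positive)
  have split: "t ^ card (pluses V \<sigma>) = t ^ card R * t ^ card (pluses V \<sigma> - R)" if "R \<subseteq> pluses V \<sigma>" for \<sigma>
  proof -
    have "card (pluses V \<sigma>) = card R + card (pluses V \<sigma> - R)"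
      using that finite_pluses[OF V, of \<sigma>] by (metis card_Diff_subset card_mono finite_subset le_add_diff_inverse)
    then show ?thesis by (simp add: power_add)
  qed
  have "measure_pmf.prob tilted {\<sigma>. R \<subseteq> pluses V \<sigma>} = mean tilted (\<lambda>\<sigma>. if \<sigma> \<in> {\<sigma>. R \<subseteq> pluses V \<sigma>} then 1 else 0)"
    by (rule mean_indicator[symmetric]) (simp add: set_pmf_tilt fin)
  also have "\<dots> = (\<Sum>\<sigma>\<in>set_pmf \<mu>. t ^ card R / N *
      (if R \<subseteq> pluses V \<sigma> then pmf \<mu> \<sigma> * 1 * t ^ card (pluses V \<sigma> - R) else 0))"
    unfolding mean_def set_pmf_tilt by (intro sum.cong refl) (auto simp: pmf_tilt_const N_def split)
  also have "\<dots> = t ^ card R / N * Z"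
    unfolding psum_def sum_distrib_left ..
  finally have prob: "measure_pmf.prob tilted {\<sigma>. R \<subseteq> pluses V \<sigma>} = t ^ card R / N * Z" .
  have "set_pmf tilted \<inter> {\<sigma>. R \<subseteq> pluses V \<sigma>} \<noteq> {}"
    using occurs by (auto simp: set_pmf_tilt)
  then have "pmf pinned_plus \<sigma> =
      (if R \<subseteq> pluses V \<sigma> then pmf tilted \<sigma> / (t ^ card R / N * Z) else 0)"
    unfolding pinned_def restrict_eq_plus_iff by (simp add: pmf_cond prob)
  then show ?thesis
    using N Z_pos t by (auto simp: pmf_tilt_const N_def[symmetric] split)
qed

lemma set_pmf_pinned_plus: "set_pmf pinned_plus \<subseteq> set_pmf \<mu>"
  by (auto simp: set_pmf_iff pmf_pinned_plus split: if_splits)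

lemma mean_pinned_plus: "mean pinned_plus g = psum V \<mu> g R t / Z"
proof -
  have "mean pinned_plus g = (\<Sum>\<sigma>\<in>set_pmf \<mu>. pmf pinned_plus \<sigma> * g \<sigma>)"
    using finite_set_pmf_configs[OF V \<mu>] set_pmf_pinned_plus by (rule mean_superset)
  also have "\<dots> = psum V \<mu> g R t / Z"
    unfolding psum_def[of V \<mu> g] sum_divide_distrib by (intro sum.cong refl) (auto simp: pmf_pinned_plus)
  finally show ?thesis .
qed

lemma finite_pinned_plus: "finite (set_pmf pinned_plus)"
  using set_pmf_pinned_plus finite_set_pmf_configs[OF V \<mu>] finite_subset by blast

lemma var_pinned_plus: "Z * var pinned_plus f = local_var V \<mu> f R t"
  using Z_pos unfolding var_eq[OF finite_pinned_plus] mean_pinned_plus local_var_def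
  by (simp add: right_diff_distrib power2_eq_square)

text \<open>With \<open>A\<close>, \<open>A'\<close>, \<open>Z\<close>, \<open>Z'\<close> as in
  \<open>jump\<close>, the mean is \<open>t * Z' / Z\<close> and the covariance is this mean times
  \<open>A' / Z' - A / Z\<close>. If \<open>insert v R\<close> is infeasible, both sides are
  0.\<close>

lemma cov_pinned_plus:
  assumes v: "v \<in> V - R"
  shows "(cov pinned_plus f (plus_at v))\<^sup>2 / mean pinned_plus (plus_at v) = t / Z * jump V \<mu> f R t v"
proof -
  note ins = psum_insert[OF V finite_set_pmf_configs[OF V \<mu>] v]
  have m: "mean pinned_plus (plus_at v) = t * psum V \<mu> (\<lambda>_. 1) (insert v R) t / Z"
    using ins[of "\<lambda>_. 1" t] by (simp add: mean_pinned_plus)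
  have c: "cov pinned_plus f (plus_at v) =
      t * psum V \<mu> f (insert v R) t / Z - psum V \<mu> f R t / Z * (t * psum V \<mu> (\<lambda>_. 1) (insert v R) t / Z)"
    unfolding cov_def m unfolding mean_pinned_plus ins by simp
  show ?thesis
  proof (cases "\<exists>\<sigma>\<in>set_pmf \<mu>. insert v R \<subseteq> pluses V \<sigma>")
    case True
    then have "psum V \<mu> (\<lambda>_. 1) (insert v R) t > 0"
      using psum_pos_iff[OF V finite_set_pmf_configs[OF V \<mu>] t] by blast
    then show ?thesis
      unfolding m c jump_def Let_def using Z_pos t
      by (simp add: field_simps power2_eq_square)
  next
    case False
    then show ?thesis unfolding m c jump_def Let_def by (simp add: psum_eq_0)
  qed
qed

text \<open>The rate in the Gronwall argument: spectral independence of the tilt at level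
  \<open>t\<close> gives \<open>1 + \<eta>\<close>, and inverting the factor \<open>t\<close> of
  \<open>cov_pinned_plus\<close> gives \<open>1 / t\<close>.\<close>

lemma sum_jump_le:
  assumes "spectrally_independent V \<eta> tilted" "\<eta> > 0"
  shows "(\<Sum>v\<in>V - R. jump V \<mu> f R t v) \<le> (1 + \<eta>) / t * local_var V \<mu> f R t"
proof -
  have "t / Z * (\<Sum>v\<in>V - R. jump V \<mu> f R t v)
      = (\<Sum>v\<in>V - R. (cov pinned_plus f (plus_at v))\<^sup>2 / mean pinned_plus (plus_at v))"
    unfolding sum_distrib_left by (intro sum.cong refl) (simp only: cov_pinned_plus)
  also have "\<dots> \<le> (1 + \<eta>) * var pinned_plus f"
    using V \<mu> assms R feasible_plus set_pmf_pinned_plus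
    by (intro spectrally_independent_sum_cov_squares_le) auto
  also have "\<dots> = (1 + \<eta>) * local_var V \<mu> f R t / Z"
    using Z_pos by (simp add: var_pinned_plus[symmetric])
  finally show ?thesis using Z_pos t by (simp add: field_simps)
qed

end

text \<open>\<open>\<mu>\<close> is the mixture of its pinned tilts with weights \<open>(1 - t) ^ card R * psum V \<mu> (\<lambda>_. 1) R t\<close>,
  and the Dirichlet form is concave in the distribution.\<close>

lemma gap_GD_min_total_local_var_le:
  fixes V :: "'v set" and \<mu> :: "'v config pmf"
  assumes V: "finite V" and \<mu>: "set_pmf \<mu> \<subseteq> configs V" and t: "0 < t" "t \<le> 1"
  shows "gap_GD_min V (tilt V (\<lambda>_. t) \<mu>) * total_local_var V \<mu> f t \<le> dirichlet V \<mu> f"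
proof -
  let ?q = "tilt V (\<lambda>_. t) \<mu>"
  let ?\<nu> = "\<lambda>R. pinned ?q R (restrict (\<lambda>_. 1) R)"
  let ?occ = "\<lambda>R. \<exists>\<sigma>\<in>set_pmf \<mu>. R \<subseteq> pluses V \<sigma>"
  let ?c = "\<lambda>R. (1 - t) ^ card R * psum V \<mu> (\<lambda>_. 1) R t"
  have fin: "finite (set_pmf \<mu>)" using finite_set_pmf_configs[OF V \<mu>] .
  have ex: "\<exists>\<sigma>\<in>set_pmf \<mu>. {} \<subseteq> pluses V \<sigma>" using set_pmf_not_empty[of \<mu>] by blast
  have q: "set_pmf ?q \<subseteq> configs V"
    using set_pmf_tilt[OF V \<mu> t(1) empty_subsetI ex] \<mu> by simp
  have c0: "?c R = 0" if "\<not> ?occ R" for R using psum_eq_0[OF that] by simp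
  have c: "?c R \<ge> 0" for R
  proof (cases "?occ R")
    case True
    then have "psum V \<mu> (\<lambda>_. 1) R t > 0" using psum_pos_iff[OF V fin t(1)] by blast
    then show ?thesis using t by simp
  next
    case False
    from psum_eq_0[OF this] show ?thesis by simp
  qed
  have "gap_GD_min V ?q * total_local_var V \<mu> f t
      = (\<Sum>R\<in>Pow V. gap_GD_min V ?q * ((1 - t) ^ card R * local_var V \<mu> f R t))"
    by (simp add: total_local_var_def sum_distrib_left)
  also have "\<dots> \<le> (\<Sum>R\<in>Pow V. ?c R * dirichlet V (?\<nu> R) f)"
  proof (rule sum_mono)
    fix R assume "R \<in> Pow V"
    then have R: "R \<subseteq> V" by simp
    show "gap_GD_min V ?q * ((1 - t) ^ card R * local_var V \<mu> f R t) \<le> ?c R * dirichlet V (?\<nu> R) f"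
    proof (cases "?occ R")
      case True
      note ctx = V \<mu> t(1) R True
      have supp: "set_pmf (?\<nu> R) \<subseteq> configs V" using set_pmf_pinned_plus[OF ctx] \<mu> by blast
      have "gap_GD_min V ?q * var (?\<nu> R) f \<le> gap_GD V (?\<nu> R) * var (?\<nu> R) f"
        using gap_GD_min_bounds(3)[OF V q R feasible_plus[OF ctx]] var_nonneg by (rule mult_right_mono)
      also have "\<dots> \<le> dirichlet V (?\<nu> R) f" by (rule gap_GD_poincare[OF V supp])
      finally have "?c R * (gap_GD_min V ?q * var (?\<nu> R) f) \<le> ?c R * dirichlet V (?\<nu> R) f"
        using c by (intro mult_left_mono)
      then show ?thesis
        unfolding var_pinned_plus[OF ctx, symmetric] by (simp only: mult.assoc mult.left_commute)
    next
      case False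
      then show ?thesis by (simp add: local_var_def psum_eq_0)
    qed
  qed
  also have "\<dots> \<le> dirichlet V \<mu> f"
  proof (rule dirichlet_mixture)
    show "set_pmf (?\<nu> R) \<subseteq> set_pmf \<mu>" if "R \<in> Pow V" "?c R \<noteq> 0" for R
      using set_pmf_pinned_plus[OF V \<mu> t(1), of R] that c0[of R] by blast
    show "(\<Sum>R\<in>Pow V. ?c R * pmf (?\<nu> R) \<sigma>) = pmf \<mu> \<sigma>" if \<sigma>: "\<sigma> \<in> set_pmf \<mu>" for \<sigma>
    proof -
      \<comment> \<open>The mixture identity at \<open>\<sigma>\<close> is \<open>psum_total\<close>
        for the indicator of \<open>\<sigma>\<close>.\<close>
      let ?g = "\<lambda>\<sigma>'. if \<sigma>' = \<sigma> then 1 else 0"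
      have "?c R * pmf (?\<nu> R) \<sigma> = (1 - t) ^ card R * psum V \<mu> ?g R t" if R: "R \<in> Pow V" for R
      proof (cases "?occ R")
        case True
        have "psum V \<mu> ?g R t = (if R \<subseteq> pluses V \<sigma> then pmf \<mu> \<sigma> * t ^ card (pluses V \<sigma> - R) else 0)"
        proof -
          have "psum V \<mu> ?g R t = (\<Sum>\<sigma>'\<in>set_pmf \<mu>. if \<sigma>' = \<sigma> then
              (if R \<subseteq> pluses V \<sigma> then pmf \<mu> \<sigma> * t ^ card (pluses V \<sigma> - R) else 0) else 0)"
            unfolding psum_def by (intro sum.cong refl) auto
          then show ?thesis using fin \<sigma> by simp
        qed
        then show ?thesis
          using pmf_pinned_plus[OF V \<mu> t(1) _ True, of \<sigma>] Z_pos[OF V \<mu> t(1) _ True] R by simp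
      next
        case False
        then show ?thesis by (simp add: psum_eq_0)
      qed
      then have "(\<Sum>R\<in>Pow V. ?c R * pmf (?\<nu> R) \<sigma>) = mean \<mu> ?g"
        unfolding psum_total[OF V fin, of t, symmetric] by (intro sum.cong refl)
      also have "\<dots> = (\<Sum>\<sigma>'\<in>set_pmf \<mu>. if \<sigma>' = \<sigma> then pmf \<mu> \<sigma> else 0)"
        unfolding mean_def by (intro sum.cong) auto
      also have "\<dots> = pmf \<mu> \<sigma>" using fin \<sigma> by simp
      finally show ?thesis .
    qed
  qed (use fin V c in auto)
  finally show ?thesis .
qed

theorem theorem1p4:
  fixes V :: "'v set" and \<mu> :: "'v config pmf" and \<eta> :: real
  assumes "finite V"
    and "set_pmf \<mu> \<subseteq> configs V"
    and "\<eta> > 0"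
    and "completely_spectrally_independent V \<eta> \<mu>"
  shows "\<forall>\<theta>::real. 0 < \<theta> \<and> \<theta> < 1 \<longrightarrow>
           gap_GD V \<mu> \<ge> (\<theta> / 2) powr (2 * \<eta> + 7) * gap_GD_min V (tilt V (\<lambda>_. \<theta>) \<mu>)"
proof (intro allI impI)
  fix \<theta> :: real assume "0 < \<theta> \<and> \<theta> < 1"
  then have \<theta>: "0 < \<theta>" "\<theta> < 1" by auto
  note V = assms(1) and \<mu> = assms(2)
  have fin: "finite (set_pmf \<mu>)" using finite_set_pmf_configs[OF V \<mu>] .
  define m where "m = gap_GD_min V (tilt V (\<lambda>_. \<theta>) \<mu>)"
  have ex: "\<exists>\<sigma>\<in>set_pmf \<mu>. {} \<subseteq> pluses V \<sigma>" using set_pmf_not_empty[of \<mu>] by blast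
  have "set_pmf (tilt V (\<lambda>_. \<theta>) \<mu>) \<subseteq> configs V"
    using set_pmf_tilt[OF V \<mu> \<theta>(1) empty_subsetI ex] \<mu> by simp
  note m = gap_GD_min_bounds[OF V this, folded m_def]
  \<comment> \<open>The localization yields the factor \<open>\<theta> powr (1 + \<eta>)\<close>.
    The claimed one is smaller: its exponent is larger at a base below 1, and its base is
    smaller.\<close>
  have "(\<theta> / 2) powr (2 * \<eta> + 7) \<le> (\<theta> / 2) powr (1 + \<eta>)"
    using \<theta> assms(3) by (intro powr_mono') auto
  also have "\<dots> \<le> \<theta> powr (1 + \<eta>)"
    using \<theta> assms(3) by (intro powr_mono2) auto
  finally have pw: "(\<theta> / 2) powr (2 * \<eta> + 7) \<le> \<theta> powr (1 + \<eta>)" .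
  have "\<theta> powr (1 + \<eta>) * m \<le> gap_GD V \<mu>"
  proof (rule gap_GD_geI[OF V \<mu>])
    have "\<theta> powr (1 + \<eta>) \<le> 1" using \<theta> assms(3) by (intro powr_le1) auto
    then show "\<theta> powr (1 + \<eta>) * m \<le> 1" using m(1,2) by (intro mult_le_one) auto
    fix f :: "'v config \<Rightarrow> real"
    have "\<theta> powr (1 + \<eta>) * var \<mu> f \<le> total_local_var V \<mu> f \<theta>"
    proof (rule var_le_total_local_var[OF V fin \<theta>])
      fix R t assume R: "R \<subseteq> V" and t: "0 < t" "t \<le> (1::real)"
      show "(\<Sum>v\<in>V - R. jump V \<mu> f R t v) \<le> (1 + \<eta>) / t * local_var V \<mu> f R t"
      proof (cases "\<exists>\<sigma>\<in>set_pmf \<mu>. R \<subseteq> pluses V \<sigma>")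
        case True
        \<comment> \<open>A constant field \<open>t\<close> in \<open>(0, 1]\<close> is admissible
          in complete spectral independence; every level from \<open>\<theta>\<close> up to 1 is
          needed along the localization.\<close>
        have "spectrally_independent V \<eta> (tilt V (\<lambda>_. t) \<mu>)"
          using assms(4) t by (simp add: completely_spectrally_independent_def)
        then show ?thesis using assms(3) by (rule sum_jump_le[OF V \<mu> t(1) R True])
      next
        case False
        then have "\<not> (\<exists>\<sigma>\<in>set_pmf \<mu>. insert v R \<subseteq> pluses V \<sigma>)" for v by auto
        then show ?thesis using False by (simp add: local_var_def jump_def psum_eq_0)
      qed
    qed
    then have "m * (\<theta> powr (1 + \<eta>) * var \<mu> f) \<le> m * total_local_var V \<mu> f \<theta>"
      using m(1) by (intro mult_left_mono)
    also have "\<dots> \<le> dirichlet V \<mu> f"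
      unfolding m_def by (rule gap_GD_min_total_local_var_le[OF V \<mu>]) (use \<theta> in auto)
    finally show "\<theta> powr (1 + \<eta>) * m * var \<mu> f \<le> dirichlet V \<mu> f" by (simp add: mult_ac)
  qed
  moreover have "(\<theta> / 2) powr (2 * \<eta> + 7) * m \<le> \<theta> powr (1 + \<eta>) * m"
    using pw m(1) by (rule mult_right_mono)
  ultimately show "gap_GD V \<mu> \<ge> (\<theta> / 2) powr (2 * \<eta> + 7) * gap_GD_min V (tilt V (\<lambda>_. \<theta>) \<mu>)"
    unfolding m_def by simp
qed

end
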